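(* Let $t>1$ be an integer, and let $\delta_t^e(n)=p_t^e(n)/p(n)$ and $\delta_t^o(n)=p_t^o(n)/p(n)$. 1) If $t$ is even, then $\lim_{n\to\infty}\delta_t^e(n)=\lim_{n\to\infty}\delta_t^o(n)=\frac12$. 2) If $t$ is odd, then as $n\to\infty$ through even integers, $\delta_t^e(n)\to\frac12+\frac1{2^{(t+1)/2}}$ and $\delta_t^o(n)\to\frac12-\frac1{2^{(t+1)/2}}$; and as $n\to\infty$ through odd integers, $\delta_t^e(n)\to\frac12-\frac1{2^{(t+1)/2}}$ and $\delta_t^o(n)\to\frac12+\frac1{2^{(t+1)/2}}$.
   Context: For a partition $\lambda$, each cell of its Young diagram has a hook number: the number of cells directly to its right in its row plus the number of cells directly below it in its column, plus one for the cell itself. $\mathcal H_t(\lambda)$ is the multiset of hook numbers of $\lambda$ that are multiples of $t$ (the $t$-hooks). $p(n)$ is the number of partitions of $n$, and $p_t^e(n)=\#\{\lambda\vdash n:\#\mathcal H_t(\lambda)\equiv0\pmod 2\}$, $p_t^o(n)=\#\{\lambda\vdash n:\#\mathcal H_t(\lambda)\equiv1\pmod2\}$, where $\#\mathcal H_t(\lambda)$ is counted with multiplicity. *)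

theory Defs
  imports Complex_Main "HOL-Library.Multiset"
begin

text \<open>A partition of \<open>n\<close> is the weakly decreasing list of its (positive) parts.\<close>

definition partitions_of :: "nat \<Rightarrow> nat list set" where
  "partitions_of n = {mu. sorted_wrt (\<ge>) mu \<and> (\<forall>k \<in> set mu. k > 0) \<and> sum_list mu = n}"

text \<open>Cells are pairs (row, column), both counted from 0, rows going downwards.\<close>

definition young_diagram :: "nat list \<Rightarrow> (nat \<times> nat) set" where
  "young_diagram mu = {(i, j). i < length mu \<and> j < mu ! i}"

definition hook_number :: "nat list \<Rightarrow> nat \<times> nat \<Rightarrow> nat" where
  "hook_number mu = (\<lambda>(i, j).
     card {j'. j < j' \<and> (i, j') \<in> young_diagram mu} +
     card {i'. i < i' \<and> (i', j) \<in> young_diagram mu} + 1)"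

definition t_hooks :: "nat \<Rightarrow> nat list \<Rightarrow> nat multiset" where
  "t_hooks t mu =
     filter_mset (\<lambda>h. t dvd h) (image_mset (hook_number mu) (mset_set (young_diagram mu)))"

definition num_partitions :: "nat \<Rightarrow> nat" where
  "num_partitions n = card (partitions_of n)"

definition p_even :: "nat \<Rightarrow> nat \<Rightarrow> nat" where
  "p_even t n = card {mu \<in> partitions_of n. even (size (t_hooks t mu))}"

definition p_odd :: "nat \<Rightarrow> nat \<Rightarrow> nat" where
  "p_odd t n = card {mu \<in> partitions_of n. odd (size (t_hooks t mu))}"

definition delta_even :: "nat \<Rightarrow> nat \<Rightarrow> real" where
  "delta_even t n = real (p_even t n) / real (num_partitions n)"

definition delta_odd :: "nat \<Rightarrow> nat \<Rightarrow> real" where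
  "delta_odd t n = real (p_odd t n) / real (num_partitions n)"

text \<open>The sets counted above and the diagrams are finite, so \<open>card\<close> and \<open>mset_set\<close> have
  their intended meaning.\<close>

lemma finite_partitions_of: "finite (partitions_of n)"
proof (rule finite_subset)
  have "length xs \<le> sum_list xs" if "\<forall>k \<in> set xs. k > 0" for xs :: "nat list"
    using that by (induction xs) auto
  then show "partitions_of n \<subseteq> {xs. set xs \<subseteq> {..n} \<and> length xs \<le> n}"
    by (auto simp: partitions_of_def intro: member_le_sum_list)
qed (simp add: finite_lists_length_le)

lemma finite_young_diagram: "finite (young_diagram mu)"
proof -
  have "young_diagram mu = (SIGMA i:{..<length mu}. {..<mu ! i})"
    by (auto simp: young_diagram_def)
  then show ?thesis by simp
qed

end

theory Submission
  imports Defs "HOL-Library.FuncSet" "HOL-Real_Asymp.Real_Asymp"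
begin

text \<open>
  On the \<open>t\<close>-runner abacus a partition of \<open>n\<close> becomes a vector \<open>x\<close> of runner charges with sum \<open>0\<close>,
  which determines the \<open>t\<close>-core, together with \<open>t\<close> partitions; the number of \<open>t\<close>-hooks is
  \<open>h = (n - Q(x)) / t\<close>, the total size of the latter, where \<open>Q(x)\<close> is the size of the core, a
  quadratic polynomial in \<open>x\<close>. So the number \<open>W(x)\<close> of partitions of \<open>n\<close> with charge vector \<open>x\<close> is
  the number of \<open>t\<close>-tuples of partitions of total size \<open>h\<close>, a slowly growing function of \<open>h\<close>, and the
  parity of \<open>h\<close> depends only on \<open>n\<close> and \<open>x\<close>.

  For a fixed lattice vector \<open>v\<close> that preserves \<open>Q\<close> modulo \<open>t\<close>, the sum of \<open>|W(x) - W(x + v)|\<close> over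
  all \<open>x\<close> is \<open>o(p(n))\<close>: along each line in direction \<open>v\<close> the function \<open>W\<close> is unimodal, so the sum
  over a line is at most twice its maximum, and by slow growth the maximum is negligible against the
  total mass of the line. Hence the sign \<open>(-1)^h\<close> may be averaged over such translations. If \<open>t\<close> is
  even, some translation flips the sign. If \<open>t\<close> is odd, then \<open>(-1)^h = (-1)^n (-1)^Q(x)\<close>, and
  \<open>(-1)^Q(x)\<close> depends only on \<open>x\<close> modulo \<open>2\<close>; averaging over all parity patterns gives a product of
  factors \<open>(1 \<plusminus> \<i>) / 2\<close> with value \<open>2^(-(t - 1)/2)\<close>.
\<close>

section \<open>Growth of the partition function\<close>

definition mpart :: "nat \<Rightarrow> nat multiset set" where
  "mpart n = {M. 0 \<notin># M \<and> sum_mset M = n}"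

lemma bij_betw_mset_partitions: "bij_betw mset (partitions_of n) (mpart n)"
proof (rule bij_betw_byWitness[where f' = "\<lambda>M. rev (sorted_list_of_multiset M)"])
  show "\<forall>mu\<in>partitions_of n. rev (sorted_list_of_multiset (mset mu)) = mu"
  proof
    fix mu assume "mu \<in> partitions_of n"
    then have "sorted (rev mu)"
      by (simp add: partitions_of_def sorted_wrt_rev)
    then have "sort mu = rev mu"
      by (intro properties_for_sort) auto
    then show "rev (sorted_list_of_multiset (mset mu)) = mu" by simp
  qed
  show "mset ` partitions_of n \<subseteq> mpart n"
    by (auto simp: partitions_of_def mpart_def sum_mset_sum_list)
  show "(\<lambda>M. rev (sorted_list_of_multiset M)) ` mpart n \<subseteq> partitions_of n"
    by (auto simp: partitions_of_def mpart_def sorted_wrt_rev sum_mset_sum_list[symmetric]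
        intro!: gr0I)
qed auto

lemma num_partitions_eq: "num_partitions n = card (mpart n)"
  unfolding num_partitions_def by (rule bij_betw_same_card[OF bij_betw_mset_partitions])

lemma finite_mpart: "finite (mpart n)"
  using bij_betw_finite[OF bij_betw_mset_partitions] finite_partitions_of by blast

text \<open>Removing one part 1 matches the partitions of \<open>Suc n\<close> that contain a 1 with
  all partitions of \<open>n\<close>. So the growth of the partition function is governed by the
  partitions without ones.\<close>

lemma num_partitions_Suc:
  "num_partitions (Suc n) = num_partitions n + card {M \<in> mpart (Suc n). 1 \<notin># M}"
proof -
  have "mpart (Suc n) = add_mset 1 ` mpart n \<union> {M \<in> mpart (Suc n). 1 \<notin># M}" (is "_ = ?A \<union> ?B")
  proof (intro equalityI subsetI)
    fix M assume M: "M \<in> mpart (Suc n)"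
    show "M \<in> ?A \<union> ?B"
    proof (cases "1 \<in># M")
      case True
      then obtain M' where "M = add_mset 1 M'" by (meson mset_add)
      then show ?thesis using M by (auto simp: mpart_def)
    qed (use M in auto)
  qed (auto simp: mpart_def)
  moreover have "card (?A \<union> ?B) = card ?A + card ?B"
    by (rule card_Un_disjoint) (auto simp: finite_mpart)
  moreover have "card ?A = card (mpart n)"
    by (rule card_image) (auto simp: inj_on_def)
  ultimately show ?thesis by (metis num_partitions_eq)
qed

lemma sum_mset_ge_mem: "(k::nat) \<in># M \<Longrightarrow> k \<le> sum_mset M"
  by (auto dest!: multi_member_split)

text \<open>Trading one part \<open>k\<close> for \<open>k\<close> ones is injective on partitions without ones, since \<open>k\<close>
  can then be read off as the number of ones.\<close>

lemma sum_distinct_parts_le: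
  "(\<Sum>M | M \<in> mpart n \<and> 1 \<notin># M. card (set_mset M)) \<le> num_partitions n"
proof -
  let ?D = "{M. M \<in> mpart n \<and> 1 \<notin># M}"
  let ?f = "\<lambda>(M, k). (M - {#k#}) + replicate_mset k (1::nat)"
  have "inj_on ?f (SIGMA M:?D. set_mset M)"
  proof (rule inj_onI, clarify)
    fix M k M' k'
    assume M: "1 \<notin># M" "k \<in># M" "1 \<notin># M'" "k' \<in># M'"
      and eq: "M - {#k#} + replicate_mset k 1 = M' - {#k'#} + replicate_mset k' 1"
    have "count (M - {#k#}) 1 = 0" "count (M' - {#k'#}) 1 = 0"
      using M(1,3) by (simp_all add: not_in_iff)
    with arg_cong[OF eq, of "\<lambda>M. count M 1"] have "k = k'" by simp
    with eq have "M - {#k#} = M' - {#k#}" by simp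
    then have "add_mset k (M - {#k#}) = add_mset k (M' - {#k#})" by simp
    with M(2,4) \<open>k = k'\<close> show "M = M' \<and> k = k'" by simp
  qed
  moreover have "?f ` (SIGMA M:?D. set_mset M) \<subseteq> mpart n"
  proof (intro image_subsetI)
    fix x assume "x \<in> (SIGMA M:?D. set_mset M)"
    then obtain M k where x: "x = (M, k)" and M: "M \<in> mpart n" "1 \<notin># M" "k \<in># M" by auto
    from M(3) obtain N where "M = add_mset k N" by (meson mset_add)
    with M x show "?f x \<in> mpart n" by (auto simp: mpart_def)
  qed
  ultimately have "card (SIGMA M:?D. set_mset M) \<le> card (mpart n)"
    by (intro card_inj_on_le[OF _ _ finite_mpart])
  then show ?thesis by (simp add: num_partitions_eq finite_mpart)
qed

lemma sum_replicate_count: "(\<Sum>k\<in>set_mset M. replicate_mset (count M k) k) = M"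
proof (rule multiset_eqI)
  fix x
  have "count (\<Sum>k\<in>set_mset M. replicate_mset (count M k) k) x
      = (\<Sum>k\<in>set_mset M. if k = x then count M k else 0)"
    by (auto simp: count_sum intro!: sum.cong)
  also have "\<dots> = count M x" by (simp add: not_in_iff)
  finally show "count (\<Sum>k\<in>set_mset M. replicate_mset (count M k) k) x = count M x" .
qed

lemma sum_list_replicate_empty: "sum_list (replicate m {#}) = {#}"
  by (induction m) auto

text \<open>Such a partition is encoded by \<open>K\<close> pairs (part, multiplicity), all of whose
  entries are at most \<open>n\<close>.\<close>

lemma card_few_distinct_parts:
  "card {M \<in> mpart n. card (set_mset M) \<le> K} \<le> (n + 1) ^ (2 * K)"
proof -
  let ?L = "{l. set l \<subseteq> {..n} \<times> {..n} \<and> length l = K}"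
  let ?f = "\<lambda>l. sum_list (map (\<lambda>(k, m). replicate_mset m (k::nat)) l)"
  have "{M \<in> mpart n. card (set_mset M) \<le> K} \<subseteq> ?f ` ?L"
  proof
    fix M assume "M \<in> {M \<in> mpart n. card (set_mset M) \<le> K}"
    then have M: "M \<in> mpart n" "card (set_mset M) \<le> K" by auto
    have cnt: "k \<le> n" "count M k \<le> n" if "k \<in># M" for k
    proof -
      show "k \<le> n" using M(1) sum_mset_ge_mem[OF that] by (auto simp: mpart_def)
      have "replicate_mset (count M k) k \<subseteq># M" by (simp flip: count_le_replicate_mset_subset_eq)
      then obtain N where "M = replicate_mset (count M k) k + N"
        unfolding mset_subset_eq_exists_conv by blast
      then have sum: "sum_mset M = count M k * k + sum_mset N"
        by (metis sum_mset.union sum_mset_replicate_mset mult.commute of_nat_id)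
      have "k \<ge> 1" using M(1) that by (cases k) (auto simp: mpart_def)
      then have "count M k * 1 \<le> count M k * k" by (intro mult_le_mono2)
      moreover have "sum_mset M = n" using M(1) by (simp add: mpart_def)
      ultimately show "count M k \<le> n" using sum by linarith
    qed
    define l0 where "l0 = map (\<lambda>k. (k, count M k)) (sorted_list_of_set (set_mset M))"
    \<comment> \<open>The pairs \<open>(0, 0)\<close> contribute the empty multiset and pad the code
      to length exactly \<open>K\<close>.\<close>
    define l where "l = l0 @ replicate (K - card (set_mset M)) (0, 0)"
    have "?f l0 = M"
      using sum_replicate_count[of M]
      by (simp add: l0_def o_def sum_list_distinct_conv_sum_set)
    then have "?f l = M"
      by (simp add: l_def sum_list_replicate_empty)
    moreover have "l \<in> ?L" using M(2) cnt by (auto simp: l_def l0_def)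
    ultimately show "M \<in> ?f ` ?L" by blast
  qed
  then have "card {M \<in> mpart n. card (set_mset M) \<le> K} \<le> card (?f ` ?L)"
    by (rule card_mono[rotated]) (simp add: finite_lists_length_eq)
  also have "\<dots> \<le> card ?L" by (rule card_image_le) (simp add: finite_lists_length_eq)
  also have "\<dots> = (n + 1) ^ (2 * K)"
    by (simp add: card_lists_length_eq card_cartesian_product power_mult power2_eq_square)
  finally show ?thesis .
qed

text \<open>A subset of \<open>{2..s}\<close> has sum at most \<open>s * s\<close>, can be filled up
  with ones to a partition of \<open>n\<close>, and is recovered as the set of parts other than 1.
  This gives \<open>2 ^ (s - 1)\<close> partitions when \<open>s > 0\<close>.\<close>

lemma num_partitions_ge_power2:
  assumes "s * s \<le> n"
  shows "2 ^ s \<le> 2 * num_partitions n"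
proof (cases "s = 0")
  case True
  have "mpart n \<noteq> {}"
    by (auto simp: mpart_def intro!: exI[of _ "replicate_mset n (Suc 0)"] split: if_splits)
  with finite_mpart[of n] True show ?thesis by (simp add: num_partitions_eq card_gt_0_iff Suc_le_eq)
next
  case False
  let ?f = "\<lambda>S. mset_set S + replicate_mset (n - \<Sum>S) (1::nat)"
  have le: "\<Sum>S \<le> n" and fin: "finite S" if "S \<in> Pow {2..s}" for S
  proof -
    show "finite S" using that by (auto intro: finite_subset)
    have "\<Sum>S \<le> \<Sum>{2..s}" using that by (intro sum_mono2) auto
    also have "\<dots> \<le> card {2..s} * s" by (rule sum_bounded_above[where K = s, simplified]) auto
    also have "\<dots> \<le> s * s" by simp
    finally show "\<Sum>S \<le> n" using assms by simp
  qed
  have "inj_on ?f (Pow {2..s})"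
  proof (rule inj_onI)
    fix S S' assume S: "S \<in> Pow {2..s}" "S' \<in> Pow {2..s}" and eq: "?f S = ?f S'"
    have "set_mset (?f T) - {1} = T" if "T \<in> Pow {2..s}" for T
      using that fin[OF that] by auto
    from this[OF S(1)] this[OF S(2)] show "S = S'" unfolding eq by simp
  qed
  moreover have "?f ` Pow {2..s} \<subseteq> mpart n"
  proof (intro image_subsetI)
    fix S assume S: "S \<in> Pow {2..s}"
    have "sum_mset (mset_set S) = \<Sum>S" using fin[OF S] by (simp add: sum_unfold_sum_mset)
    then show "?f S \<in> mpart n" using le[OF S] fin[OF S] S by (auto simp: mpart_def split: if_splits)
  qed
  ultimately have "card (Pow {2..s}) \<le> card (mpart n)" by (intro card_inj_on_le[OF _ _ finite_mpart])
  then have "2 ^ (s - 1) \<le> num_partitions n" by (simp add: card_Pow num_partitions_eq)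
  then have "2 * 2 ^ (s - 1) \<le> 2 * num_partitions n" by simp
  then show ?thesis using False by (cases s) auto
qed

lemma num_partitions_pos: "num_partitions n > 0"
  using num_partitions_ge_power2[of 0 n] by simp


text \<open>For s the integer part of the square root of \<open>n\<close>, the preceding bound gives
  at least a quarter of \<open>2 powr sqrt n\<close>: one factor 2 comes from that bound, the other
  from rounding.\<close>

lemma num_partitions_superpolynomial:
  fixes C K :: nat
  shows "\<forall>\<^sub>F n in sequentially. C * (n + 1) ^ K \<le> num_partitions n"
proof -
  have "(\<lambda>n. real C * (real n + 1) ^ K / (2 powr sqrt (real n) / 4)) \<longlonglongrightarrow> 0"
    by real_asymp
  then have "\<forall>\<^sub>F n in sequentially. real C * (real n + 1) ^ K / (2 powr sqrt (real n) / 4) < 1"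
    by (rule order_tendstoD) simp
  then show ?thesis
  proof eventually_elim
    case (elim n)
    define s where "s = nat \<lfloor>sqrt (real n)\<rfloor>"
    have "sqrt (real n) - 1 \<le> real s" "real s \<le> sqrt (real n)" by (simp_all add: s_def)
    have "real (s * s) \<le> real n"
      using mult_mono[OF \<open>real s \<le> sqrt n\<close> \<open>real s \<le> sqrt n\<close>] by simp
    then have "s * s \<le> n" by linarith
    then have "2 ^ s \<le> 2 * num_partitions n" by (rule num_partitions_ge_power2)
    then have "real (2 ^ s) \<le> real (2 * num_partitions n)" by (simp only: of_nat_le_iff)
    then have "2 ^ s \<le> 2 * real (num_partitions n)" by simp
    moreover have "2 powr (sqrt (real n) - 1) \<le> 2 powr real s"
      using \<open>sqrt (real n) - 1 \<le> real s\<close> by simp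
    ultimately have "2 powr sqrt (real n) / 4 \<le> real (num_partitions n)"
      by (simp add: powr_diff powr_realpow)
    moreover have "real C * (real n + 1) ^ K < 2 powr sqrt (real n) / 4"
      using elim by (simp add: field_simps)
    ultimately have "real (C * (n + 1) ^ K) \<le> real (num_partitions n)"
      by (simp add: add.commute)
    then show ?case by linarith
  qed
qed

lemma num_partitions_mono: "m \<le> n \<Longrightarrow> num_partitions m \<le> num_partitions n"
  by (rule lift_Suc_mono_le[of num_partitions]) (simp_all add: num_partitions_Suc)

text \<open>Partitions with more than \<open>K\<close> distinct parts have weight above
  \<open>K\<close> in \<open>sum_distinct_parts_le\<close>; those with at most \<open>K\<close> are
  only polynomially many.\<close>

lemma partitions_without_ones_negligible:
  "\<forall>\<^sub>F n in sequentially. K * card {M \<in> mpart n. 1 \<notin># M} \<le> 2 * num_partitions n"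
  using num_partitions_superpolynomial[of K "2 * K"]
proof eventually_elim
  case (elim n)
  let ?D = "{M \<in> mpart n. 1 \<notin># M}" and ?F = "{M \<in> mpart n. card (set_mset M) \<le> K}"
  have fin: "finite ?D" "finite ?F" by (simp_all add: finite_mpart)
  have "K * card (?D - ?F) = (\<Sum>M\<in>?D - ?F. K)" by simp
  also have "\<dots> \<le> (\<Sum>M\<in>?D - ?F. card (set_mset M))" by (intro sum_mono) auto
  also have "\<dots> \<le> (\<Sum>M\<in>?D. card (set_mset M))" using fin by (intro sum_mono2) auto
  also have "\<dots> \<le> num_partitions n" by (rule sum_distinct_parts_le)
  finally have 1: "K * card (?D - ?F) \<le> num_partitions n" .
  have "card ?D \<le> card ((?D - ?F) \<union> ?F)" using fin by (intro card_mono) auto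
  also have "\<dots> \<le> card (?D - ?F) + card ?F" by (rule card_Un_le)
  finally have "K * card ?D \<le> K * (card (?D - ?F) + card ?F)" by (rule mult_le_mono2)
  then have "K * card ?D \<le> K * card (?D - ?F) + K * card ?F" by (simp only: distrib_left)
  moreover have "K * card ?F \<le> K * (n + 1) ^ (2 * K)"
    by (intro mult_le_mono2 card_few_distinct_parts)
  ultimately show ?case using 1 elim by linarith
qed

section \<open>Slow growth, for partitions and for tuples of partitions\<close>

text \<open>The order of the quantifiers matters: one \<open>c\<close> serves all shifts
  \<open>k\<close>, and only the threshold for \<open>n\<close> depends on \<open>k\<close>.\<close>

definition slowly_growing :: "(nat \<Rightarrow> nat) \<Rightarrow> bool" where
  "slowly_growing a \<longleftrightarrow> (\<exists>c. \<forall>k. \<forall>\<^sub>F n in sequentially. a (n + k) \<le> c * a n)"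

text \<open>The increase from \<open>n\<close> to \<open>n + k\<close> is a sum of \<open>k\<close>
  counts of partitions without ones. For large \<open>n\<close> each is at most a
  \<open>2 * k\<close>-th of \<open>num_partitions (n + k)\<close>, so the increase is at most half
  of the new value.\<close>

lemma slowly_growing_num_partitions: "slowly_growing num_partitions"
  unfolding slowly_growing_def
proof (intro exI[of _ 2] allI)
  fix k
  let ?d = "\<lambda>n. card {M \<in> mpart n. 1 \<notin># M}"
  obtain N where N: "\<And>n. n \<ge> N \<Longrightarrow> (4 * k) * ?d n \<le> 2 * num_partitions n"
    using partitions_without_ones_negligible[of "4 * k"] by (auto simp: eventually_sequentially)
  have sum: "num_partitions (n + j) = num_partitions n + (\<Sum>i<j. ?d (Suc (n + i)))" for n j
    by (induction j) (simp_all add: num_partitions_Suc)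
  show "\<forall>\<^sub>F n in sequentially. num_partitions (n + k) \<le> 2 * num_partitions n"
    unfolding eventually_sequentially
  proof (intro exI[of _ N] allI impI)
    fix n assume "n \<ge> N"
    have "(4 * k) * ?d (Suc (n + i)) \<le> 2 * num_partitions (n + k)" if "i < k" for i
      using N[of "Suc (n + i)"] num_partitions_mono[of "Suc (n + i)" "n + k"] \<open>n \<ge> N\<close> that by simp
    then have "(\<Sum>i<k. (4 * k) * ?d (Suc (n + i))) \<le> (\<Sum>i<k. 2 * num_partitions (n + k))"
      by (intro sum_mono) auto
    then have "(4 * k) * (\<Sum>i<k. ?d (Suc (n + i))) \<le> k * (2 * num_partitions (n + k))"
      by (simp add: sum_distrib_left)
    then have "k * (2 * (\<Sum>i<k. ?d (Suc (n + i)))) \<le> k * num_partitions (n + k)" by simp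
    then have "2 * (\<Sum>i<k. ?d (Suc (n + i))) \<le> num_partitions (n + k)"
      by (cases "k = 0") simp_all
    with sum[of n k] show "num_partitions (n + k) \<le> 2 * num_partitions n" by simp
  qed
qed

text \<open>The number of \<open>s\<close>-tuples of partitions of total size \<open>j\<close>, as
  an iterated convolution.\<close>

fun multi_partitions :: "nat \<Rightarrow> nat \<Rightarrow> nat" where
  "multi_partitions 0 j = (if j = 0 then 1 else 0)"
| "multi_partitions (Suc s) j = (\<Sum>i\<le>j. multi_partitions s i * num_partitions (j - i))"

lemma multi_partitions_1: "multi_partitions (Suc 0) j = num_partitions j"
proof -
  have "multi_partitions (Suc 0) j = (\<Sum>i\<le>j. if i = 0 then num_partitions j else 0)"
    unfolding multi_partitions.simps by (intro sum.cong) auto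
  also have "\<dots> = num_partitions j" by simp
  finally show ?thesis .
qed

text \<open>Stated for \<open>Suc s\<close> since \<open>multi_partitions 0\<close> drops from 1 to
  0.\<close>

lemma multi_partitions_mono:
  assumes "i \<le> j"
  shows "multi_partitions (Suc s) i \<le> multi_partitions (Suc s) j"
proof -
  have "multi_partitions (Suc s) i
      \<le> (\<Sum>l\<le>i. multi_partitions s l * num_partitions (j - l))"
    using assms by (auto intro!: sum_mono mult_le_mono2 num_partitions_mono)
  also have "\<dots> \<le> multi_partitions (Suc s) j"
    unfolding multi_partitions.simps using assms by (intro sum_mono2) auto
  finally show ?thesis .
qed

text \<open>In the convolution at \<open>n + k\<close>, the terms whose second argument is large are
  controlled by slow growth of \<open>num_partitions\<close> and cost the factor \<open>e\<close>.
  The remaining \<open>m + k\<close> terms are dominated by a long block of terms of the convolution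
  at \<open>n\<close>, which costs 1 more; hence \<open>e + 1\<close>, independent of
  \<open>k\<close>.\<close>

lemma slowly_growing_multi_partitions: "slowly_growing (multi_partitions (Suc s))"
proof (induction s)
  case 0
  have "multi_partitions (Suc 0) = num_partitions" by (intro ext multi_partitions_1)
  then show ?case using slowly_growing_num_partitions by simp
next
  case (Suc s)
  let ?a = "multi_partitions (Suc s)" and ?P = "multi_partitions (Suc (Suc s))"
  obtain c where c: "\<And>k. \<forall>\<^sub>F n in sequentially. ?a (n + k) \<le> c * ?a n"
    using Suc unfolding slowly_growing_def by blast
  obtain e where e: "\<And>k. \<forall>\<^sub>F n in sequentially. num_partitions (n + k) \<le> e * num_partitions n"
    using slowly_growing_num_partitions unfolding slowly_growing_def by blast
  show ?case unfolding slowly_growing_def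
  proof (intro exI[of _ "e + 1"] allI)
    fix k
    obtain m where m: "\<And>n. n \<ge> m \<Longrightarrow> num_partitions (n + k) \<le> e * num_partitions n"
      using e[of k] by (auto simp: eventually_sequentially)
    \<comment> \<open>\<open>B\<close> bounds the number of tail terms times their largest second
      factor. The length \<open>L\<close> is chosen so that \<open>L\<close> terms, each at least
      \<open>?a (n - L)\<close>, make up for \<open>B\<close> and for two uses of slow growth of
      \<open>?a\<close>.\<close>
    define B where "B = (m + k) * num_partitions (m + k)"
    define L where "L = B * c * c"
    obtain N1 where N1: "\<And>n. n \<ge> N1 \<Longrightarrow> ?a (n + k) \<le> c * ?a n"
      using c[of k] by (auto simp: eventually_sequentially)
    obtain N2 where N2: "\<And>n. n \<ge> N2 \<Longrightarrow> ?a (n + L) \<le> c * ?a n"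
      using c[of L] by (auto simp: eventually_sequentially)
    show "\<forall>\<^sub>F n in sequentially. ?P (n + k) \<le> (e + 1) * ?P n"
      unfolding eventually_sequentially
    proof (intro exI[of _ "N1 + N2 + L + m"] allI impI)
      fix n assume n: "n \<ge> N1 + N2 + L + m"
      have split: "{..n + k} = {..n - m} \<union> {n - m<..n + k}" using n by auto
      have "?P (n + k) = (\<Sum>i\<le>n - m. ?a i * num_partitions (n + k - i))
          + (\<Sum>i\<in>{n - m<..n + k}. ?a i * num_partitions (n + k - i))"
        unfolding multi_partitions.simps(2)[of "Suc s"] split by (rule sum.union_disjoint) auto
      also have "(\<Sum>i\<le>n - m. ?a i * num_partitions (n + k - i))
          \<le> (\<Sum>i\<le>n - m. ?a i * (e * num_partitions (n - i)))"
      proof (intro sum_mono mult_le_mono2)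
        fix i assume "i \<in> {..n - m}"
        then show "num_partitions (n + k - i) \<le> e * num_partitions (n - i)"
          using m[of "n - i"] n by simp
      qed
      also have "\<dots> = e * (\<Sum>i\<le>n - m. ?a i * num_partitions (n - i))"
        by (simp add: sum_distrib_left mult_ac)
      also have "\<dots> \<le> e * ?P n"
        unfolding multi_partitions.simps(2)[of "Suc s"] by (intro mult_le_mono2 sum_mono2) auto
      also have "(\<Sum>i\<in>{n - m<..n + k}. ?a i * num_partitions (n + k - i))
          \<le> (\<Sum>i\<in>{n - m<..n + k}. ?a (n + k) * num_partitions (m + k))"
        by (intro sum_mono mult_le_mono multi_partitions_mono num_partitions_mono) auto
      also have "\<dots> = B * ?a (n + k)" using n by (simp add: B_def)
      also have "\<dots> \<le> B * (c * ?a n)" using N1 n by (intro mult_le_mono2) auto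
      also have "\<dots> \<le> B * (c * (c * ?a (n - L)))"
        using N2[of "n - L"] n by (intro mult_le_mono2) auto
      also have "\<dots> = (\<Sum>i\<in>{n - L<..n}. ?a (n - L) * 1)" using n by (simp add: L_def)
      also have "\<dots> \<le> (\<Sum>i\<in>{n - L<..n}. ?a i * num_partitions (n - i))"
        using num_partitions_pos by (intro sum_mono mult_le_mono multi_partitions_mono) (auto simp: Suc_le_eq)
      also have "\<dots> \<le> ?P n"
        unfolding multi_partitions.simps(2)[of "Suc s"] by (intro sum_mono2) auto
      finally show "?P (n + k) \<le> (e + 1) * ?P n" by simp
    qed
  qed
qed

section \<open>Hooks and cores on the abacus\<close>

text \<open>With the elements of \<open>S\<close> read as beads, this counts the pairs of a bead and
  a lower gap, which will be the cells of the partition encoded by \<open>S\<close>.\<close>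

definition inversions :: "nat set \<Rightarrow> nat" where
  "inversions S = card {(a, b). a \<in> S \<and> b \<notin> S \<and> b < a}"

lemma finite_pairs_below:
  fixes B :: "nat set"
  assumes "finite B"
  shows "finite {(a, b). a \<in> B \<and> b < a \<and> P a b}"
proof -
  have "{(a, b). a \<in> B \<and> b < a \<and> P a b} \<subseteq> (SIGMA a:B. {..<a})" by auto
  then show ?thesis using assms by (auto intro: finite_subset)
qed

lemma sum_card_below:
  fixes S :: "nat set"
  assumes "finite S"
  shows "(\<Sum>a\<in>S. card {b \<in> S. b < a}) = card S choose 2"
  using assms
proof (induction rule: finite_linorder_max_induct)
  case (insert m S)
  have "{b \<in> insert m S. b < a} = {b \<in> S. b < a}" if "a \<in> S" for a
    using insert.hyps that by force
  moreover have "{b \<in> insert m S. b < m} = S" using insert.hyps by auto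
  moreover have "m \<notin> S" using insert.hyps by auto
  ultimately show ?case
    using insert by (simp add: numeral_2_eq_2)
qed simp

text \<open>The \<open>a\<close> positions below a bead \<open>a\<close> are gaps or beads; summed
  over all beads, the latter give every pair of beads once.\<close>

lemma inversions_sum:
  assumes "finite S"
  shows "inversions S + (card S choose 2) = \<Sum>S"
proof -
  have "{(a, b). a \<in> S \<and> b \<notin> S \<and> b < a} = (SIGMA a:S. {b. b \<notin> S \<and> b < a})" by auto
  then have "inversions S = (\<Sum>a\<in>S. card {b. b \<notin> S \<and> b < a})"
    using assms by (simp add: inversions_def)
  also have "\<dots> + (card S choose 2) = (\<Sum>a\<in>S. card {b. b \<notin> S \<and> b < a} + card {b \<in> S. b < a})"
    by (simp add: sum_card_below[OF assms, symmetric] sum.distrib)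
  also have "\<dots> = (\<Sum>a\<in>S. a)"
  proof (intro sum.cong refl)
    fix a
    have "{b. b \<notin> S \<and> b < a} \<union> {b \<in> S. b < a} = {..<a}" by auto
    moreover have "card ({b. b \<notin> S \<and> b < a} \<union> {b \<in> S. b < a})
        = card {b. b \<notin> S \<and> b < a} + card {b \<in> S. b < a}"
      by (rule card_Un_disjoint) auto
    ultimately show "card {b. b \<notin> S \<and> b < a} + card {b \<in> S. b < a} = a" by simp
  qed
  finally show ?thesis .
qed

section \<open>Beta sets of partitions\<close>

text \<open>Rows below the diagram count as empty, so a beta set may have more beads than the
  partition has parts.\<close>

definition part_at :: "nat list \<Rightarrow> nat \<Rightarrow> nat" where
  "part_at mu i = (if i < length mu then mu ! i else 0)"

text \<open>The classical beta numbers: the staircase N - 1, ..., 1, 0 is added to the padded parts,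
  which makes them strictly decreasing.\<close>

definition beta :: "nat \<Rightarrow> nat list \<Rightarrow> nat \<Rightarrow> nat" where
  "beta N mu i = part_at mu i + (N - 1 - i)"

definition beta_set :: "nat \<Rightarrow> nat list \<Rightarrow> nat set" where
  "beta_set N mu = beta N mu ` {..<N}"

definition beta_sets :: "nat \<Rightarrow> nat \<Rightarrow> nat set set" where
  "beta_sets N n = {B. finite B \<and> card B = N \<and> inversions B = n}"

lemma part_at_antimono:
  assumes "sorted_wrt (\<ge>) mu" "i \<le> k"
  shows "part_at mu k \<le> part_at mu i"
  using assms by (cases "i = k") (auto simp: part_at_def sorted_wrt_iff_nth_less)

lemma beta_strict_antimono:
  assumes "sorted_wrt (\<ge>) mu" "i < k" "k < N"
  shows "beta N mu k < beta N mu i"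
  using part_at_antimono[OF assms(1), of i k] assms(2,3) by (simp add: beta_def)

lemma inj_on_beta:
  assumes "sorted_wrt (\<ge>) mu"
  shows "inj_on (beta N mu) {..<N}"
proof (rule inj_onI)
  fix i k assume "i \<in> {..<N}" "k \<in> {..<N}" "beta N mu i = beta N mu k"
  then show "i = k"
    using beta_strict_antimono[OF assms, of i k N] beta_strict_antimono[OF assms, of k i N]
    by (cases i k rule: linorder_cases) auto
qed

lemma card_beta_set: "sorted_wrt (\<ge>) mu \<Longrightarrow> card (beta_set N mu) = N"
  by (simp add: beta_set_def card_image inj_on_beta)

lemma sum_part_at: "length mu \<le> N \<Longrightarrow> (\<Sum>i<N. part_at mu i) = sum_list mu"
proof -
  assume "length mu \<le> N"
  then have "(\<Sum>i<N. part_at mu i) = (\<Sum>i<length mu. part_at mu i)"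
    by (intro sum.mono_neutral_right) (auto simp: part_at_def)
  also have "\<dots> = sum_list mu"
    by (simp add: part_at_def sum_list_sum_nth atLeast0LessThan)
  finally show ?thesis .
qed

lemma sum_lessThan_choose_2: "(\<Sum>i<N. i) = N choose 2"
  by (induction N) (simp_all add: numeral_2_eq_2)

text \<open>The staircase contributes \<open>N choose 2\<close> to the sum of the beta set, exactly
  the correction term in \<open>inversions_sum\<close>.\<close>

lemma inversions_beta_set:
  assumes "sorted_wrt (\<ge>) mu" "length mu \<le> N"
  shows "inversions (beta_set N mu) = sum_list mu"
proof -
  have "\<Sum>(beta_set N mu) = (\<Sum>i<N. beta N mu i)"
    unfolding beta_set_def by (simp add: sum.reindex inj_on_beta assms)
  also have "\<dots> = sum_list mu + (\<Sum>i<N. N - 1 - i)"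
    unfolding beta_def sum.distrib by (simp only: sum_part_at[OF assms(2)])
  also have "(\<Sum>i<N. N - 1 - i) = N choose 2"
    using sum.nat_diff_reindex[of "\<lambda>i. i" N] by (simp add: sum_lessThan_choose_2)
  finally show ?thesis
    using inversions_sum[of "beta_set N mu"] card_beta_set[OF assms(1), of N]
    by (simp add: beta_set_def)
qed

lemma length_le_sum_list: "\<forall>k\<in>set mu. k > (0::nat) \<Longrightarrow> length mu \<le> sum_list mu"
  by (induction mu) auto

text \<open>In a weakly decreasing list the zeros form a tail, so deleting them moves no positive
  entry, and \<open>part_at\<close> reads 0 there anyway.\<close>

lemma part_at_filter:
  assumes "sorted_wrt (\<ge>) xs"
  shows "part_at (filter (\<lambda>x. x > 0) xs) i = part_at xs i"
  using assms
proof (induction xs arbitrary: i)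
  case (Cons x xs)
  show ?case
  proof (cases "x > 0")
    case True
    have step: "part_at (y # ys) i = (case i of 0 \<Rightarrow> y | Suc k \<Rightarrow> part_at ys k)" for y ys
      by (cases i) (simp_all add: part_at_def)
    have "part_at (filter (\<lambda>x. x > 0) xs) k = part_at xs k" for k
      using Cons.IH[of k] Cons.prems by simp
    then show ?thesis using True by (simp add: step split: nat.split)
  next
    case False
    then have "\<forall>y\<in>set (x # xs). y = 0" using Cons.prems by auto
    then have "filter (\<lambda>x. x > 0) (x # xs) = []" by (simp add: filter_empty_conv)
    moreover have "part_at (x # xs) i = 0"
      using \<open>\<forall>y\<in>set (x # xs). y = 0\<close> by (simp add: part_at_def del: set_simps)
    ultimately show ?thesis by (simp add: part_at_def)
  qed
qed simp

lemma sorted_list_of_beta_set: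
  assumes "sorted_wrt (\<ge>) mu"
  shows "sorted_list_of_set (beta_set N mu) = map (\<lambda>k. beta N mu (N - 1 - k)) [0..<N]"
proof -
  have "sorted_wrt (<) (map (\<lambda>k. beta N mu (N - 1 - k)) [0..<N])"
    using beta_strict_antimono[OF assms] by (simp add: sorted_wrt_iff_nth_less)
  moreover have "set (map (\<lambda>k. beta N mu (N - 1 - k)) [0..<N]) = beta_set N mu"
  proof -
    have "(\<lambda>k. N - 1 - k) ` {..<N} = {..<N}"
    proof (intro equalityI subsetI)
      fix k assume "k \<in> {..<N}"
      then show "k \<in> (\<lambda>k. N - 1 - k) ` {..<N}" by (intro image_eqI[of _ _ "N - 1 - k"]) auto
    qed auto
    then have "beta_set N mu = beta N mu ` (\<lambda>k. N - 1 - k) ` {..<N}"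
      by (simp only: beta_set_def)
    then show ?thesis by (simp add: atLeast0LessThan image_image)
  qed
  ultimately show ?thesis
    using sorted_list_of_set.idem_if_sorted_distinct[of "map (\<lambda>k. beta N mu (N - 1 - k)) [0..<N]"]
    by (simp add: strict_sorted_iff)
qed

lemma strict_sorted_nth_ge:
  assumes "sorted_wrt (<) (l :: nat list)" "i \<le> k" "k < length l"
  shows "l ! i + (k - i) \<le> l ! k"
  using assms(2,3)
proof (induction k rule: dec_induct)
  case (step k)
  then have "l ! k < l ! Suc k" using assms(1) by (simp add: sorted_wrt_iff_nth_less)
  with step show ?case by simp
qed simp

text \<open>A partition of \<open>n\<close> has at most \<open>n\<close> parts, so \<open>N\<close>
  beads suffice. Conversely, subtracting the staircase from the ordered beads and dropping zeros
  recovers the partition.\<close>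

lemma bij_betw_beta_set:
  assumes "n \<le> N"
  shows "bij_betw (beta_set N) (partitions_of n) (beta_sets N n)"
proof (rule bij_betw_imageI)
  have part: "sorted_wrt (\<ge>) mu" "length mu \<le> N" "\<forall>k\<in>set mu. k > 0" "sum_list mu = n"
    if "mu \<in> partitions_of n" for mu
    using that length_le_sum_list[of mu] assms by (auto simp: partitions_of_def)
  show "inj_on (beta_set N) (partitions_of n)"
  proof (rule inj_onI)
    fix mu nu assume mu: "mu \<in> partitions_of n" and nu: "nu \<in> partitions_of n"
      and eq: "beta_set N mu = beta_set N nu"
    have nth: "beta N mu (N - 1 - k) = beta N nu (N - 1 - k)" if "k < N" for k
      using arg_cong[OF eq, of "\<lambda>B. sorted_list_of_set B ! k"] that
      by (simp add: sorted_list_of_beta_set part mu nu)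
    have "beta N mu i = beta N nu i" if "i < N" for i
      using nth[of "N - 1 - i"] that by simp
    then have "part_at mu i = part_at nu i" if "i < N" for i
      using that unfolding beta_def by (metis add_right_cancel)
    moreover have "part_at mu i = part_at nu i" if "i \<ge> N" for i
      using that part(2)[OF mu] part(2)[OF nu] by (simp add: part_at_def)
    ultimately have at: "part_at mu i = part_at nu i" for i by (cases "i < N") auto
    have len: "i < length l \<longleftrightarrow> part_at l i > 0" if "l \<in> partitions_of n" for l i
      using part(3)[OF that] by (auto simp: part_at_def)
    have "i < length mu \<longleftrightarrow> i < length nu" for i
      using at len[OF mu] len[OF nu] by simp
    then have "length mu = length nu"
      by (cases "length mu" "length nu" rule: linorder_cases) auto
    then show "mu = nu"
    proof (rule nth_equalityI)
      fix i assume "i < length mu"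
      with at[of i] \<open>length mu = length nu\<close> show "mu ! i = nu ! i" by (simp add: part_at_def)
    qed
  qed
  show "beta_set N ` partitions_of n = beta_sets N n"
  proof (intro equalityI image_subsetI subsetI)
    fix mu assume "mu \<in> partitions_of n"
    note p = part[OF this]
    show "beta_set N mu \<in> beta_sets N n"
      using p card_beta_set[OF p(1), of N] inversions_beta_set[OF p(1,2)]
      by (simp add: beta_sets_def) (simp add: beta_set_def)
  next
    fix B assume B: "B \<in> beta_sets N n"
    define l where "l = sorted_list_of_set B"
    have l: "sorted_wrt (<) l" "length l = N" "set l = B"
      using B by (auto simp: l_def beta_sets_def)
    \<comment> \<open>The largest bead comes first, matching the order of the rows. Strictly
      increasing positions in \<open>l\<close> become weakly decreasing parts, possibly ending in
      zeros.\<close>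
    define xs where "xs = map (\<lambda>i. l ! (N - 1 - i) - (N - 1 - i)) [0..<N]"
    define mu where "mu = filter (\<lambda>x. x > 0) xs"
    have ge: "k \<le> l ! k" if "k < N" for k
      using strict_sorted_nth_ge[OF l(1), of 0 k] that l(2) by simp
    have srt: "sorted_wrt (\<ge>) xs"
      unfolding sorted_wrt_iff_nth_less
    proof (intro allI impI)
      fix i k assume ik: "i < k" "k < length xs"
      then have "l ! (N - 1 - k) + (k - i) \<le> l ! (N - 1 - i)"
        using strict_sorted_nth_ge[OF l(1), of "N - 1 - k" "N - 1 - i"] l(2)
        by (simp add: xs_def)
      with ik show "xs ! i \<ge> xs ! k" by (simp add: xs_def)
    qed
    then have srt': "sorted_wrt (\<ge>) mu" by (simp add: mu_def sorted_wrt_filter)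
    have len: "length mu \<le> N" by (simp add: mu_def xs_def le_trans[OF length_filter_le])
    have "beta N mu i = l ! (N - 1 - i)" if "i < N" for i
      using that ge[of "N - 1 - i"] part_at_filter[OF srt, of i]
      by (simp add: beta_def mu_def) (simp add: part_at_def xs_def)
    then have "beta_set N mu = (\<lambda>i. l ! (N - 1 - i)) ` {..<N}"
      by (simp add: beta_set_def)
    also have "\<dots> = B"
    proof (intro equalityI subsetI)
      fix b assume "b \<in> B"
      then obtain k where "k < N" "b = l ! k" using l by (metis in_set_conv_nth)
      then show "b \<in> (\<lambda>i. l ! (N - 1 - i)) ` {..<N}"
        by (intro image_eqI[of _ _ "N - 1 - k"]) auto
    qed (use l in auto)
    finally have eq: "beta_set N mu = B" .
    have "sum_list mu = n"
      using inversions_beta_set[OF srt' len] B eq by (simp add: beta_sets_def)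
    with srt' have "mu \<in> partitions_of n" by (auto simp: partitions_of_def mu_def)
    with eq show "B \<in> beta_set N ` partitions_of n" by blast
  qed
qed

lemma card_beta_sets: "n \<le> N \<Longrightarrow> card (beta_sets N n) = num_partitions n"
  unfolding num_partitions_def using bij_betw_same_card[OF bij_betw_beta_set] by simp

section \<open>Hooks as pairs of a bead and a lower gap\<close>

definition col_length :: "nat list \<Rightarrow> nat \<Rightarrow> nat" where
  "col_length mu j = card {i. j < part_at mu i}"

text \<open>The rows that reach column \<open>j\<close> form an initial segment, so membership is a
  comparison with its cardinality. This is conjugation of partitions.\<close>

lemma less_part_at_iff:
  assumes "sorted_wrt (\<ge>) mu"
  shows "j < part_at mu i \<longleftrightarrow> i < col_length mu j"
proof -
  let ?A = "{i. j < part_at mu i}"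
  have fin: "finite ?A"
    by (rule finite_subset[of _ "{..<length mu}"]) (auto simp: part_at_def split: if_splits)
  have down: "k \<in> ?A" if "i \<in> ?A" "k \<le> i" for i k
    using part_at_antimono[OF assms that(2)] that(1) by simp
  show ?thesis
  proof
    assume "j < part_at mu i"
    then have "{..i} \<subseteq> ?A" using down by auto
    then have "card {..i} \<le> card ?A" using fin by (rule card_mono[rotated])
    then show "i < col_length mu j" by (simp add: col_length_def)
  next
    assume *: "i < col_length mu j"
    show "j < part_at mu i"
    proof (rule ccontr)
      assume "\<not> j < part_at mu i"
      then have "?A \<subseteq> {..<i}" using down[of _ i] by (auto simp: not_less[symmetric])
      then have "card ?A \<le> card {..<i}" by (intro card_mono) auto
      with * show False by (simp add: col_length_def)
    qed
  qed
qed

text \<open>Column \<open>j\<close> corresponds to a gap of the beta set, and the hook number of the cell \<open>(i, j)\<close>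
  is the distance from this gap to the \<open>i\<close>-th bead.\<close>

definition gap :: "nat \<Rightarrow> nat list \<Rightarrow> nat \<Rightarrow> nat" where
  "gap N mu j = j + N - col_length mu j"

lemma young_diagram_iff: "(i, j) \<in> young_diagram mu \<longleftrightarrow> j < part_at mu i"
  by (simp add: young_diagram_def part_at_def)

lemma hook_number_eq:
  assumes "sorted_wrt (\<ge>) mu" "j < part_at mu i"
  shows "hook_number mu (i, j) = (part_at mu i - j - 1) + (col_length mu j - i - 1) + 1"
proof -
  have "{j'. j < j' \<and> (i, j') \<in> young_diagram mu} = {j<..<part_at mu i}"
    by (auto simp: young_diagram_iff)
  moreover have "{i'. i < i' \<and> (i', j) \<in> young_diagram mu} = {i<..<col_length mu j}"
    by (auto simp: young_diagram_iff less_part_at_iff[OF assms(1)])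
  ultimately show ?thesis by (simp add: hook_number_def)
qed

lemma hook_number_eq_diff:
  assumes "sorted_wrt (\<ge>) mu" "length mu \<le> N" "(i, j) \<in> young_diagram mu"
  shows "i < N" "gap N mu j < beta N mu i" "hook_number mu (i, j) = beta N mu i - gap N mu j"
proof -
  have j: "j < part_at mu i" using assms(3) by (simp add: young_diagram_iff)
  then have i: "i < col_length mu j" using less_part_at_iff[OF assms(1)] by simp
  have "\<not> j < part_at mu N" using assms(2) by (simp add: part_at_def)
  then have c: "col_length mu j \<le> N" using less_part_at_iff[OF assms(1)] by simp
  show "i < N" using i c by simp
  show "gap N mu j < beta N mu i" using i j c by (simp add: gap_def beta_def)
  show "hook_number mu (i, j) = beta N mu i - gap N mu j"
    using hook_number_eq[OF assms(1) j] i j c by (simp add: gap_def beta_def)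
qed

text \<open>Bead \<open>i\<close> lies strictly above gap \<open>j\<close> if \<open>(i, j)\<close>
  is a cell, and strictly below it otherwise.\<close>

lemma gap_notin_beta_set:
  assumes "sorted_wrt (\<ge>) mu" "length mu \<le> N"
  shows "gap N mu j \<notin> beta_set N mu"
proof
  assume "gap N mu j \<in> beta_set N mu"
  then obtain i where i: "i < N" "gap N mu j = beta N mu i" by (auto simp: beta_set_def)
  have "\<not> j < part_at mu N" using assms(2) by (simp add: part_at_def)
  then have c: "col_length mu j \<le> N" using less_part_at_iff[OF assms(1)] by simp
  show False
  proof (cases "j < part_at mu i")
    case True
    with less_part_at_iff[OF assms(1)] have "i < col_length mu j" by simp
    with True i c show False by (simp add: gap_def beta_def)
  next
    case False
    with less_part_at_iff[OF assms(1)] have "col_length mu j \<le> i" by (simp add: not_less)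
    with False i c show False by (simp add: gap_def beta_def)
  qed
qed

lemma gap_strict_mono:
  assumes "sorted_wrt (\<ge>) mu" "length mu \<le> N" "j < k"
  shows "gap N mu j < gap N mu k"
proof -
  have "\<not> j < part_at mu N" using assms(2) by (simp add: part_at_def)
  then have c: "col_length mu j \<le> N" using less_part_at_iff[OF assms(1)] by simp
  have "i < col_length mu j" if "i < col_length mu k" for i
    using that assms(3) by (simp flip: less_part_at_iff[OF assms(1)])
  from this[of "col_length mu j"] have "col_length mu k \<le> col_length mu j" by (meson less_irrefl not_le)
  with c assms(3) show ?thesis by (simp add: gap_def)
qed

text \<open>One inclusion is known, and the cardinalities agree: of the
  \<open>part_at mu i + (N - 1 - i)\<close> positions below bead \<open>i\<close>, the beads of the
  later rows occupy \<open>N - 1 - i\<close>.\<close>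

lemma gaps_below_beta:
  assumes "sorted_wrt (\<ge>) mu" "length mu \<le> N" "i < N"
  shows "gap N mu ` {..<part_at mu i} = {b. b \<notin> beta_set N mu \<and> b < beta N mu i}"
proof (rule card_subset_eq)
  show "finite {b. b \<notin> beta_set N mu \<and> b < beta N mu i}" by simp
  show "gap N mu ` {..<part_at mu i} \<subseteq> {b. b \<notin> beta_set N mu \<and> b < beta N mu i}"
    using hook_number_eq_diff(2)[OF assms(1,2)] gap_notin_beta_set[OF assms(1,2)]
    by (auto simp: young_diagram_iff)
  have "{b \<in> beta_set N mu. b < beta N mu i} = beta N mu ` {i<..<N}"
  proof (intro equalityI subsetI)
    fix b assume "b \<in> {b \<in> beta_set N mu. b < beta N mu i}"
    then obtain k where k: "k < N" "b = beta N mu k" "beta N mu k < beta N mu i"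
      by (auto simp: beta_set_def)
    then have "i < k" using beta_strict_antimono[OF assms(1), of k i N] assms(3)
      by (cases i k rule: linorder_cases) auto
    with k show "b \<in> beta N mu ` {i<..<N}" by auto
  qed (use beta_strict_antimono[OF assms(1)] in \<open>auto simp: beta_set_def\<close>)
  then have "card {b \<in> beta_set N mu. b < beta N mu i} = N - 1 - i"
    using card_image[OF inj_on_subset[OF inj_on_beta[OF assms(1), of N], of "{i<..<N}"]]
    by fastforce
  moreover have "card {..<beta N mu i} = card ({b. b \<notin> beta_set N mu \<and> b < beta N mu i}
      \<union> {b \<in> beta_set N mu. b < beta N mu i})"
    by (rule arg_cong[where f = card]) auto
  moreover have "\<dots> = card {b. b \<notin> beta_set N mu \<and> b < beta N mu i}
      + card {b \<in> beta_set N mu. b < beta N mu i}"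
    by (rule card_Un_disjoint) auto
  ultimately have "card {b. b \<notin> beta_set N mu \<and> b < beta N mu i} = part_at mu i"
    by (simp add: beta_def)
  moreover have "inj (gap N mu)"
    using gap_strict_mono[OF assms(1,2)] by (intro linorder_injI) (simp add: less_imp_neq)
  ultimately show "card (gap N mu ` {..<part_at mu i})
      = card {b. b \<notin> beta_set N mu \<and> b < beta N mu i}"
    by (simp add: card_image inj_on_subset)
qed

definition t_inversions :: "nat \<Rightarrow> nat set \<Rightarrow> nat" where
  "t_inversions t B = card {(a, b). a \<in> B \<and> b \<notin> B \<and> b < a \<and> t dvd a - b}"

text \<open>Cells correspond to pairs of a bead and a lower gap, with the hook number as their
  distance.\<close>

lemma size_t_hooks:
  assumes "sorted_wrt (\<ge>) mu" "length mu \<le> N"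
  shows "size (t_hooks t mu) = t_inversions t (beta_set N mu)"
proof -
  let ?Y = "{c \<in> young_diagram mu. t dvd hook_number mu c}"
  let ?I = "{(a, b). a \<in> beta_set N mu \<and> b \<notin> beta_set N mu \<and> b < a \<and> t dvd a - b}"
  let ?f = "\<lambda>(i, j). (beta N mu i, gap N mu j)"
  have "size (t_hooks t mu) = card ?Y"
    by (simp add: t_hooks_def filter_mset_image_mset finite_young_diagram)
  also have "\<dots> = card ?I"
  proof (rule bij_betw_same_card[of ?f], rule bij_betw_imageI)
    have "inj (gap N mu)"
      using gap_strict_mono[OF assms] by (intro linorder_injI) (simp add: less_imp_neq)
    then show "inj_on ?f ?Y"
      using inj_on_beta[OF assms(1), of N] hook_number_eq_diff(1)[OF assms]
      by (auto simp: inj_on_def)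
    show "?f ` ?Y = ?I"
    proof (intro equalityI subsetI)
      fix p assume "p \<in> ?f ` ?Y"
      then obtain i j where p: "p = (beta N mu i, gap N mu j)" and ij: "(i, j) \<in> young_diagram mu"
        "t dvd hook_number mu (i, j)" by auto
      with hook_number_eq_diff[OF assms ij(1)] gap_notin_beta_set[OF assms, of j]
      show "p \<in> ?I" by (auto simp: beta_set_def)
    next
      fix p assume "p \<in> ?I"
      then obtain i b where p: "p = (beta N mu i, b)" and i: "i < N" and b: "b \<notin> beta_set N mu"
        "b < beta N mu i" "t dvd beta N mu i - b"
        by (auto simp: beta_set_def)
      then have "b \<in> gap N mu ` {..<part_at mu i}" using gaps_below_beta[OF assms i] by simp
      then obtain j where j: "b = gap N mu j" "j < part_at mu i" by auto
      then have "(i, j) \<in> young_diagram mu" by (simp add: young_diagram_iff)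
      with p b j hook_number_eq_diff(3)[OF assms this] show "p \<in> ?f ` ?Y"
        by (intro image_eqI[of _ _ "(i, j)"]) auto
    qed
  qed
  finally show ?thesis by (simp add: t_inversions_def)
qed


section \<open>Runners of the abacus\<close>

definition runner :: "nat \<Rightarrow> nat \<Rightarrow> nat set \<Rightarrow> nat set" where
  "runner t r B = {b. t * b + r \<in> B}"

definition join_runners :: "nat \<Rightarrow> (nat \<Rightarrow> nat set) \<Rightarrow> nat set" where
  "join_runners t F = (\<Union>r<t. (\<lambda>b. t * b + r) ` F r)"

lemma mult_add_eq_iff:
  assumes "r < t" "s < (t::nat)"
  shows "t * a + r = t * b + s \<longleftrightarrow> a = b \<and> r = s"
proof
  assume eq: "t * a + r = t * b + s"
  from arg_cong[OF eq, of "\<lambda>x. x mod t"] arg_cong[OF eq, of "\<lambda>x. x div t"] assms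
  show "a = b \<and> r = s" by simp
qed simp

lemma runner_join:
  assumes "r < t"
  shows "runner t r (join_runners t F) = F r"
  using assms by (auto simp: runner_def join_runners_def mult_add_eq_iff)

lemma join_runner:
  assumes "t > 0"
  shows "join_runners t (\<lambda>r\<in>{..<t}. runner t r B) = B"
proof (intro equalityI subsetI)
  fix b assume "b \<in> B"
  then show "b \<in> join_runners t (\<lambda>r\<in>{..<t}. runner t r B)"
    using assms unfolding join_runners_def runner_def
    by (intro UN_I[of "b mod t"] image_eqI[of _ _ "b div t"]) auto
qed (auto simp: join_runners_def runner_def)

lemma finite_runner:
  assumes "finite B" "t > 0"
  shows "finite (runner t r B)"
proof -
  have "inj_on (\<lambda>b. t * b + r) (runner t r B)" using assms(2) by (auto simp: inj_on_def)
  moreover have "(\<lambda>b. t * b + r) ` runner t r B \<subseteq> B" by (auto simp: runner_def)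
  ultimately show ?thesis using assms(1) by (metis finite_imageD finite_subset)
qed

lemma sum_join_runners:
  fixes g :: "nat \<Rightarrow> 'a::comm_monoid_add"
  assumes "\<And>r. r < t \<Longrightarrow> finite (F r)"
  shows "(\<Sum>x\<in>join_runners t F. g x) = (\<Sum>r<t. \<Sum>b\<in>F r. g (t * b + r))"
proof -
  have "(\<Sum>x\<in>join_runners t F. g x) = (\<Sum>r<t. \<Sum>x\<in>(\<lambda>b. t * b + r) ` F r. g x)"
    unfolding join_runners_def using assms
    by (intro sum.UNION_disjoint) (auto simp: mult_add_eq_iff)
  also have "\<dots> = (\<Sum>r<t. \<Sum>b\<in>F r. g (t * b + r))"
    by (intro sum.cong[OF refl]) (simp add: sum.reindex inj_on_def)
  finally show ?thesis .
qed

lemma sum_runners: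
  fixes g :: "nat \<Rightarrow> 'a::comm_monoid_add"
  assumes "finite B" "t > 0"
  shows "(\<Sum>x\<in>B. g x) = (\<Sum>r<t. \<Sum>b\<in>runner t r B. g (t * b + r))"
  using sum_join_runners[of t "\<lambda>r\<in>{..<t}. runner t r B" g] finite_runner[OF assms] assms(2)
  by (simp add: join_runner)

lemma card_runners:
  assumes "finite B" "t > 0"
  shows "card B = (\<Sum>r<t. card (runner t r B))"
  using sum_runners[OF assms, of "\<lambda>_. 1::nat"] by simp

text \<open>A bead and a gap differ by a multiple of \<open>t\<close> exactly when they lie on the
  same runner, where division by \<open>t\<close> turns them into an inversion.\<close>

lemma t_inversions_eq:
  assumes "finite B" "t > 0"
  shows "t_inversions t B = (\<Sum>r<t. inversions (runner t r B))"
proof -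
  let ?I = "\<lambda>r. {(a, b). a \<in> runner t r B \<and> b \<notin> runner t r B \<and> b < a}"
  let ?f = "\<lambda>(r, a, b). (t * a + r, t * b + r)"
  have "(\<Sum>r<t. inversions (runner t r B)) = card (SIGMA r:{..<t}. ?I r)"
  proof -
    have "finite (?I r)" for r
      using finite_pairs_below[OF finite_runner[OF assms, of r], of "\<lambda>a b. b \<notin> runner t r B"]
      by (rule rev_finite_subset) auto
    then show ?thesis by (simp add: inversions_def)
  qed
  also have "\<dots> = card {(a, b). a \<in> B \<and> b \<notin> B \<and> b < a \<and> t dvd a - b}"
  proof (rule bij_betw_same_card[of ?f], rule bij_betw_imageI)
    show "inj_on ?f (SIGMA r:{..<t}. ?I r)"
      by (auto simp: inj_on_def mult_add_eq_iff)
    show "?f ` (SIGMA r:{..<t}. ?I r) = {(a, b). a \<in> B \<and> b \<notin> B \<and> b < a \<and> t dvd a - b}"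
    proof (intro equalityI subsetI)
      fix p assume "p \<in> ?f ` (SIGMA r:{..<t}. ?I r)"
      then show "p \<in> {(a, b). a \<in> B \<and> b \<notin> B \<and> b < a \<and> t dvd a - b}"
        using assms(2) by (auto simp: runner_def diff_mult_distrib2[symmetric])
    next
      fix p assume "p \<in> {(a, b). a \<in> B \<and> b \<notin> B \<and> b < a \<and> t dvd a - b}"
      then obtain a b where p: "p = (a, b)" "a \<in> B" "b \<notin> B" "b < a" "t dvd a - b" by auto
      then have mod: "b mod t = a mod t" by (metis less_imp_le mod_eq_dvd_iff_nat)
      then have a: "t * (a div t) + a mod t = a" and b: "t * (b div t) + a mod t = b"
        by (metis mult_div_mod_eq)+
      then have "t * (b div t) < t * (a div t)" using p(4) by linarith
      then have "b div t < a div t" by simp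
      then have *: "(a mod t, a div t, b div t) \<in> (SIGMA r:{..<t}. ?I r)"
        using p a b assms(2) by (simp add: runner_def)
      have "p = ?f (a mod t, a div t, b div t)" using a b p by simp
      then show "p \<in> ?f ` (SIGMA r:{..<t}. ?I r)" using * by (rule image_eqI)
    qed
  qed
  finally show ?thesis by (simp add: t_inversions_def)
qed

section \<open>Core vectors and tuples of partitions on the runners\<close>

text \<open>Splitting off the last coordinate yields the convolution that defines
  \<open>multi_partitions\<close>. The bound \<open>m\<close> reflects that a runner with
  \<open>c\<close> beads represents all partitions of a given size only up to size
  \<open>c\<close>.\<close>

lemma card_PiE_sum_eq:
  assumes "\<And>r i. r < s \<Longrightarrow> i \<le> m \<Longrightarrow> card {S \<in> X r. w S = i} = num_partitions i"
    and "j \<le> m"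
  shows "card {F \<in> PiE {..<s} X. (\<Sum>r<s. w (F r)) = j} = multi_partitions s j"
  using assms
proof (induction s arbitrary: j)
  case 0
  have "{F \<in> PiE {..<0} X. (\<Sum>r<0. w (F r)) = j} = (if j = 0 then {\<lambda>_. undefined} else {})"
    by auto
  then show ?case by simp
next
  case (Suc s)
  let ?A = "\<lambda>i. {F \<in> PiE {..<s} X. (\<Sum>r<s. w (F r)) = i}"
  let ?B = "\<lambda>i. {S \<in> X s. w S = i}"
  let ?C = "{F \<in> PiE {..<Suc s} X. (\<Sum>r<Suc s. w (F r)) = j}"
  let ?D = "SIGMA i:{..j}. ?A i \<times> ?B (j - i)"
  have A: "card (?A i) = multi_partitions s i" if "i \<le> j" for i
    using Suc that by auto
  have B: "card (?B i) = num_partitions i" if "i \<le> j" for i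
    using Suc that by auto
  \<comment> \<open>Resetting coordinate \<open>s\<close> to \<open>undefined\<close> makes the
    restricted function extensional on \<open>{..<s}\<close> again.\<close>
  have "bij_betw (\<lambda>(i, F, S). F(s := S)) ?D ?C"
  proof (rule bij_betw_byWitness[where f' = "\<lambda>F. (\<Sum>r<s. w (F r), F(s := undefined), F s)"])
    show "\<forall>p\<in>?D. (\<lambda>F. (\<Sum>r<s. w (F r), F(s := undefined), F s)) ((\<lambda>(i, F, S). F(s := S)) p) = p"
      by (auto simp: PiE_def extensional_def fun_eq_iff)
    show "\<forall>F\<in>?C. (\<lambda>(i, F, S). F(s := S)) (\<Sum>r<s. w (F r), F(s := undefined), F s) = F"
      by auto
    show "(\<lambda>(i, F, S). F(s := S)) ` ?D \<subseteq> ?C"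
      by (auto simp: PiE_def extensional_def Pi_def less_Suc_eq)
    show "(\<lambda>F. (\<Sum>r<s. w (F r), F(s := undefined), F s)) ` ?C \<subseteq> ?D"
      by (auto simp: PiE_def extensional_def Pi_def less_Suc_eq)
  qed
  then have "card ?C = card ?D" by (simp add: bij_betw_same_card)
  also have "\<dots> = (\<Sum>i\<le>j. card (?A i \<times> ?B (j - i)))"
  proof (rule card_SigmaI)
    \<comment> \<open>Infinite sets have \<open>card\<close> 0, so a positive count forces
      finiteness.\<close>
    have "finite (?B i)" if "i \<le> j" for i
      using B[OF that] num_partitions_pos[of i] by (intro card_ge_0_finite) simp
    moreover have "finite (?A i)" if "i \<le> j" for i
    proof -
      have "?A i \<subseteq> PiE {..<s} (\<lambda>r. \<Union>k\<le>i. {S \<in> X r. w S = k})"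
      proof (intro subsetI PiE_I)
        fix F r assume F: "F \<in> ?A i" and r: "r \<in> {..<s}"
        then have "w (F r) \<le> i" using member_le_sum[of r "{..<s}" "\<lambda>r. w (F r)"] by simp
        with F r show "F r \<in> (\<Union>k\<le>i. {S \<in> X r. w S = k})" by auto
      qed (auto simp: PiE_def extensional_def)
      moreover have "finite {S \<in> X r. w S = k}" if "r < s" "k \<le> i" for r k
        using Suc.prems that \<open>i \<le> j\<close> num_partitions_pos[of k] by (intro card_ge_0_finite) simp
      ultimately show ?thesis by (elim finite_subset) (auto intro!: finite_PiE)
    qed
    ultimately show "\<forall>i\<in>{..j}. finite (?A i \<times> ?B (j - i))" by auto
  qed simp
  also have "\<dots> = multi_partitions (Suc s) j"
    by (simp add: card_cartesian_product A B)
  finally show ?case .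
qed

text \<open>\<open>core_vectors t\<close> is the root lattice of type \<open>A\<close>: the charges of the \<open>t\<close> runners. Twice the
  size of the core with charge vector \<open>x\<close> is \<open>core_form t x\<close>.\<close>

definition core_vectors :: "nat \<Rightarrow> (nat \<Rightarrow> int) set" where
  "core_vectors t = {x. (\<forall>r\<ge>t. x r = 0) \<and> (\<Sum>r<t. x r) = 0}"

definition core_form :: "nat \<Rightarrow> (nat \<Rightarrow> int) \<Rightarrow> int" where
  "core_form t x = (\<Sum>r<t. int t * x r ^ 2 + 2 * int r * x r)"

text \<open>With \<open>t * M\<close> beads the average runner holds \<open>M\<close>, and the
  charge is the excess over it. The value 0 from index \<open>t\<close> on makes a vector determined
  by its entries below \<open>t\<close>.\<close>

definition core_vector :: "nat \<Rightarrow> nat \<Rightarrow> nat list \<Rightarrow> nat \<Rightarrow> int" where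
  "core_vector t M mu r =
     (if r < t then int (card (runner t r (beta_set (t * M) mu))) - int M else 0)"

lemma double_choose_2: "2 * int (k choose 2) = int k ^ 2 - int k"
proof -
  have "2 * (k choose 2) + k = k ^ 2"
    by (induction k) (simp_all add: numeral_2_eq_2 algebra_simps)
  then have "2 * int (k choose 2) + int k = int k ^ 2"
    by (metis of_nat_add of_nat_mult of_nat_numeral of_nat_power)
  then show ?thesis by simp
qed

text \<open>The sum of the bead positions is evaluated by \<open>inversions_sum\<close> in two ways: on \<open>B\<close>, and on
  each of its runners.\<close>

lemma inversions_runners:
  assumes "t > 0" "finite B" "card B = t * M"
    and x: "\<And>r. r < t \<Longrightarrow> int (card (runner t r B)) = int M + x r"
  shows "2 * int (inversions B)
      = 2 * int t * int (\<Sum>r<t. inversions (runner t r B)) + core_form t x"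
proof -
  let ?c = "\<lambda>r. card (runner t r B)"
  have sumx: "(\<Sum>r<t. x r) = 0"
  proof -
    have "int (t * M) = (\<Sum>r<t. int M + x r)"
      using card_runners[OF assms(2,1)] assms(3) x by simp
    then show ?thesis by (simp add: sum.distrib)
  qed
  have gauss: "2 * (\<Sum>r<t. int r) = int t ^ 2 - int t"
    using double_choose_2[of t] by (simp flip: sum_lessThan_choose_2)
  have "\<Sum>B = (\<Sum>r<t. t * \<Sum>(runner t r B) + r * ?c r)"
    using sum_runners[OF assms(2,1), of "\<lambda>x. x"] by (simp add: sum.distrib sum_distrib_left mult.commute)
  also have "\<dots> = (\<Sum>r<t. t * inversions (runner t r B) + (t * (?c r choose 2) + r * ?c r))"
    using inversions_sum[OF finite_runner[OF assms(2,1)], symmetric]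
    by (intro sum.cong refl) (simp add: algebra_simps)
  also have "\<dots> = t * (\<Sum>r<t. inversions (runner t r B)) + (\<Sum>r<t. t * (?c r choose 2) + r * ?c r)"
    by (simp add: sum.distrib sum_distrib_left)
  finally have "inversions B + ((t * M) choose 2) = \<dots>"
    using inversions_sum[OF assms(2)] assms(3) by simp
  then have "2 * int (inversions B) + 2 * int ((t * M) choose 2)
      = 2 * int t * int (\<Sum>r<t. inversions (runner t r B))
        + 2 * int (\<Sum>r<t. t * (?c r choose 2) + r * ?c r)"
    by (simp only: of_nat_add[symmetric] of_nat_mult[symmetric] flip: distrib_left)
      (simp add: algebra_simps)
  \<comment> \<open>Each summand is split into its share of \<open>core_form\<close>, a constant
    multiple of \<open>x r\<close>, which sums to 0, and a part free of \<open>x r\<close>, which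
    sums to \<open>2 * int ((t * M) choose 2)\<close>.\<close>
  moreover have "2 * int (\<Sum>r<t. t * (?c r choose 2) + r * ?c r)
      = (\<Sum>r<t. (int t * x r ^ 2 + 2 * int r * x r)
          + ((2 * int t * int M - int t) * x r + (int t * (int M ^ 2 - int M) + int M * (2 * int r))))"
  proof -
    have "2 * int (t * (?c r choose 2) + r * ?c r) = (int t * x r ^ 2 + 2 * int r * x r)
        + ((2 * int t * int M - int t) * x r + (int t * (int M ^ 2 - int M) + int M * (2 * int r)))"
      if "r < t" for r
    proof -
      have "2 * int (t * (?c r choose 2) + r * ?c r)
          = int t * (2 * int (?c r choose 2)) + 2 * int r * int (?c r)" by simp
      also have "\<dots> = int t * ((int M + x r) ^ 2 - (int M + x r)) + 2 * int r * (int M + x r)"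
        by (simp only: double_choose_2 x[OF that])
      finally show ?thesis by (simp add: algebra_simps power2_eq_square)
    qed
    then show ?thesis by (simp only: of_nat_sum sum_distrib_left) (auto intro!: sum.cong)
  qed
  moreover have "\<dots> = core_form t x + ((2 * int t * int M - int t) * (\<Sum>r<t. x r)
      + (int t * (int t * (int M ^ 2 - int M)) + int M * (2 * (\<Sum>r<t. int r))))"
    by (simp add: core_form_def sum.distrib sum_distrib_left)
  moreover have "\<dots> = core_form t x + 2 * int ((t * M) choose 2)"
    unfolding sumx gauss double_choose_2 by (simp add: algebra_simps power2_eq_square)
  ultimately show ?thesis by linarith
qed

lemma core_vector_in:
  assumes "t > 0" "mu \<in> partitions_of n"
  shows "core_vector t M mu \<in> core_vectors t"
proof -
  let ?B = "beta_set (t * M) mu"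
  have "finite ?B" by (simp add: beta_set_def)
  then have "(\<Sum>r<t. card (runner t r ?B)) = t * M"
    using card_runners[OF _ assms(1)] card_beta_set[of mu "t * M"] assms(2)
    by (simp add: partitions_of_def)
  then have "(\<Sum>r<t. int (card (runner t r ?B))) = int (t * M)"
    by (metis of_nat_sum)
  then show ?thesis by (simp add: core_vectors_def core_vector_def sum_subtractf)
qed

text \<open>The number of \<open>t\<close>-hooks is the total number of inversions on the runners,
  so \<open>inversions_runners\<close> expresses it through \<open>n\<close> and the core vector
  alone.\<close>

lemma size_t_hooks_core:
  assumes "t > 0" "n \<le> t * M" "mu \<in> partitions_of n"
  shows "2 * int n = 2 * int t * int (size (t_hooks t mu)) + core_form t (core_vector t M mu)"
proof -
  let ?B = "beta_set (t * M) mu"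
  have B: "?B \<in> beta_sets (t * M) n"
    using bij_betw_beta_set[OF assms(2)] assms(3) by (auto simp: bij_betw_def)
  have mu: "sorted_wrt (\<ge>) mu" "length mu \<le> t * M"
    using assms(2,3) length_le_sum_list[of mu] by (auto simp: partitions_of_def)
  show ?thesis
    using inversions_runners[OF assms(1), of ?B M "core_vector t M mu"] B
    by (simp add: beta_sets_def core_vector_def size_t_hooks[OF mu] t_inversions_eq[OF _ assms(1)])
qed

text \<open>Subtracting \<open>int t - 1\<close> times the vanishing sum of the entries centres the
  linear coefficients, which then are at most \<open>int t - 1\<close> in absolute value. Each
  summand thereby dominates its own \<open>\<bar>x r\<bar>\<close>.\<close>

lemma abs_core_vector_le:
  assumes "x \<in> core_vectors t" "r < t"
  shows "\<bar>x r\<bar> \<le> core_form t x"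
proof -
  have "core_form t x = (\<Sum>r<t. int t * x r ^ 2 + 2 * int r * x r) - (int t - 1) * (\<Sum>r<t. x r)"
    using assms(1) by (simp add: core_form_def core_vectors_def)
  also have "\<dots> = (\<Sum>r<t. int t * x r ^ 2 + (2 * int r - (int t - 1)) * x r)"
    by (simp add: sum_distrib_left sum_subtractf[symmetric] algebra_simps)
  finally have eq: "core_form t x = (\<Sum>r<t. int t * x r ^ 2 + (2 * int r - (int t - 1)) * x r)" .
  have ge: "\<bar>x r\<bar> \<le> int t * x r ^ 2 + (2 * int r - (int t - 1)) * x r" if "r < t" for r
  proof -
    have "\<bar>(2 * int r - (int t - 1)) * x r\<bar> \<le> (int t - 1) * \<bar>x r\<bar>"
      unfolding abs_mult using that by (intro mult_right_mono) auto
    moreover have "\<bar>x r\<bar> * 1 \<le> \<bar>x r\<bar> * \<bar>x r\<bar>"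
    proof (cases "x r = 0")
      case False
      then have "1 \<le> \<bar>x r\<bar>" by simp
      then show ?thesis by (rule mult_left_mono) simp
    qed simp
    then have "\<bar>x r\<bar> \<le> x r ^ 2" by (simp add: power2_eq_square)
    then have "int t * \<bar>x r\<bar> \<le> int t * x r ^ 2" by (intro mult_left_mono) auto
    ultimately show ?thesis by (simp add: left_diff_distrib)
  qed
  have "\<bar>x r\<bar> \<le> int t * x r ^ 2 + (2 * int r - (int t - 1)) * x r" by (rule ge[OF assms(2)])
  also have "\<dots> \<le> core_form t x"
    unfolding eq using ge assms(2) by (intro member_le_sum) (auto intro: order_trans[OF abs_ge_zero])
  finally show ?thesis .
qed

text \<open>With at least \<open>3 * n\<close> beads per runner on average, every single runner keeps at least \<open>j\<close>
  beads, enough to represent all partitions of sizes up to \<open>j\<close>.\<close>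

lemma card_core_vector_eq:
  assumes "t > 0" "M \<ge> 3 * n" and x: "x \<in> core_vectors t"
    and j: "2 * int n = 2 * int t * int j + core_form t x"
  shows "card {mu \<in> partitions_of n. core_vector t M mu = x} = multi_partitions t j"
proof -
  have nM: "n \<le> t * M" using assms(1,2) by (cases t) auto
  have form0: "core_form t x \<ge> 0" using abs_core_vector_le[OF x, of 0] assms(1) by simp
  have "int j \<le> int t * int j" using mult_right_mono[of 1 "int t" "int j"] assms(1) by simp
  then have jn: "j \<le> n" using j form0 by simp
  define c where "c r = nat (int M + x r)" for r
  have c: "int (c r) = int M + x r" "j \<le> c r" if "r < t" for r
  proof -
    have "\<bar>x r\<bar> \<le> 2 * int n" using abs_core_vector_le[OF x that] j
      by (smt (verit) mult_nonneg_nonneg of_nat_0_le_iff)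
    then show "int (c r) = int M + x r" "j \<le> c r" using assms(2) jn unfolding c_def by linarith+
  qed
  let ?P = "{mu \<in> partitions_of n. core_vector t M mu = x}"
  let ?B = "{B \<in> beta_sets (t * M) n. \<forall>r<t. card (runner t r B) = c r}"
  let ?X = "\<lambda>r. {S. finite S \<and> card S = c r}"
  let ?F = "{F \<in> PiE {..<t} ?X. (\<Sum>r<t. inversions (F r)) = j}"
  have sumc: "(\<Sum>r<t. c r) = t * M"
  proof -
    have "int (\<Sum>r<t. c r) = (\<Sum>r<t. int M + x r)" using c(1) by simp
    also have "\<dots> = int (t * M)" using x by (simp add: core_vectors_def sum.distrib)
    finally show ?thesis by linarith
  qed
  have "bij_betw (beta_set (t * M)) ?P ?B"
  proof -
    have iff: "core_vector t M mu = x \<longleftrightarrow> (\<forall>r<t. card (runner t r (beta_set (t * M) mu)) = c r)" for mu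
    proof -
      have "core_vector t M mu = x \<longleftrightarrow> (\<forall>r<t. core_vector t M mu r = x r)"
        using x by (auto simp: fun_eq_iff core_vector_def core_vectors_def)
      also have "\<dots> \<longleftrightarrow> (\<forall>r<t. card (runner t r (beta_set (t * M) mu)) = c r)"
      proof -
        have "core_vector t M mu r = x r \<longleftrightarrow> card (runner t r (beta_set (t * M) mu)) = c r"
          if "r < t" for r
          using c(1)[OF that] that unfolding core_vector_def by simp linarith
        then show ?thesis by auto
      qed
      finally show ?thesis .
    qed
    show ?thesis
    proof (rule bij_betw_imageI)
      show "inj_on (beta_set (t * M)) ?P"
        using bij_betw_imp_inj_on[OF bij_betw_beta_set[OF nM]] by (rule inj_on_subset) auto
      show "beta_set (t * M) ` ?P = ?B"
        unfolding bij_betw_imp_surj_on[OF bij_betw_beta_set[OF nM], symmetric] iff by blast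
    qed
  qed
  then have "card ?P = card ?B" by (rule bij_betw_same_card)
  also have "\<dots> = card ?F"
  proof (rule bij_betw_same_card[OF bij_betw_byWitness
        [where f = "\<lambda>B. \<lambda>r\<in>{..<t}. runner t r B" and f' = "join_runners t"]])
    have inv: "inversions B = n \<longleftrightarrow> (\<Sum>r<t. inversions (runner t r B)) = j"
      if "finite B" "card B = t * M" "\<forall>r<t. card (runner t r B) = c r" for B
    proof -
      have "2 * int (inversions B)
          = 2 * int t * int (\<Sum>r<t. inversions (runner t r B)) + core_form t x"
        using that c(1) by (intro inversions_runners[OF assms(1)]) auto
      then have "inversions B = n \<longleftrightarrow> int t * int (\<Sum>r<t. inversions (runner t r B)) = int t * int j"
        using j by linarith
      then show ?thesis using assms(1) by (simp del: of_nat_sum)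
    qed
    show "\<forall>B\<in>?B. join_runners t (\<lambda>r\<in>{..<t}. runner t r B) = B"
      using join_runner[OF assms(1)] by auto
    show "\<forall>F\<in>?F. (\<lambda>r\<in>{..<t}. runner t r (join_runners t F)) = F"
      by (auto simp: fun_eq_iff runner_join PiE_def extensional_def restrict_def)
    show "(\<lambda>B. \<lambda>r\<in>{..<t}. runner t r B) ` ?B \<subseteq> ?F"
    proof (intro image_subsetI)
      fix B assume B: "B \<in> ?B"
      then have "(\<Sum>r<t. inversions (runner t r B)) = j"
        using inv[of B] by (simp add: beta_sets_def)
      then show "(\<lambda>r\<in>{..<t}. runner t r B) \<in> ?F"
        using B finite_runner[OF _ assms(1)] by (auto simp: beta_sets_def)
    qed
    show "join_runners t ` ?F \<subseteq> ?B"
    proof (intro image_subsetI)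
      fix F assume F: "F \<in> ?F"
      let ?J = "join_runners t F"
      have Fr: "finite (F r)" "card (F r) = c r" if "r < t" for r using F that by auto
      then have fin: "finite ?J" by (auto simp: join_runners_def)
      have "card ?J = (\<Sum>r<t. c r)"
        using sum_join_runners[of t F "\<lambda>_. 1::nat"] Fr by simp
      then have "card ?J = t * M" using sumc by simp
      moreover have r: "\<forall>r<t. card (runner t r ?J) = c r" using Fr by (simp add: runner_join)
      moreover have "(\<Sum>r<t. inversions (runner t r ?J)) = j" using F by (simp add: runner_join)
      ultimately show "?J \<in> ?B" using inv[of ?J] fin by (simp add: beta_sets_def)
    qed
  qed
  also have "\<dots> = multi_partitions t j"
  proof (rule card_PiE_sum_eq[where m = j])
    fix r i assume "r < t" "i \<le> j"
    then have "card (beta_sets (c r) i) = num_partitions i"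
      using c(2)[of r] by (intro card_beta_sets) simp
    then show "card {S \<in> ?X r. inversions S = i} = num_partitions i"
      by (simp add: beta_sets_def conj_assoc)
  qed simp
  finally show ?thesis .
qed

section \<open>Asymptotic translation invariance\<close>

definition core_count :: "nat \<Rightarrow> nat \<Rightarrow> (nat \<Rightarrow> int) \<Rightarrow> nat" where
  "core_count t n x = card {mu \<in> partitions_of n. core_vector t (3 * n) mu = x}"

text \<open>By \<open>size_t_hooks_core\<close> the quotient is the number of
  \<open>t\<close>-hooks, so no partition has this core vector unless it is a nonnegative
  integer.\<close>

lemma core_count_eq:
  assumes "t > 0" "x \<in> core_vectors t"
  shows "core_count t n x =
    (if 2 * int t dvd 2 * int n - core_form t x \<and> core_form t x \<le> 2 * int n
     then multi_partitions t (nat ((2 * int n - core_form t x) div (2 * int t))) else 0)"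
proof (cases "2 * int t dvd 2 * int n - core_form t x \<and> core_form t x \<le> 2 * int n")
  case True
  define j where "j = nat ((2 * int n - core_form t x) div (2 * int t))"
  have "2 * int t * int j = 2 * int n - core_form t x"
    using True by (simp add: j_def pos_imp_zdiv_nonneg_iff assms(1))
  then show ?thesis
    using True card_core_vector_eq[OF assms(1) order_refl assms(2), of n j]
    unfolding core_count_def j_def by simp
next
  case False
  have "{mu \<in> partitions_of n. core_vector t (3 * n) mu = x} = {}"
  proof (rule ccontr)
    assume "{mu \<in> partitions_of n. core_vector t (3 * n) mu = x} \<noteq> {}"
    then obtain mu where mu: "mu \<in> partitions_of n" "core_vector t (3 * n) mu = x" by auto
    have "n \<le> t * (3 * n)" using assms(1) by (cases t) auto
    from size_t_hooks_core[OF assms(1) this mu(1)] mu(2)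
    have *: "2 * int n - core_form t x = 2 * int t * int (size (t_hooks t mu))" by simp
    then have "2 * int t dvd 2 * int n - core_form t x" by simp
    moreover have "0 \<le> 2 * int n - core_form t x" unfolding * by simp
    ultimately show False using False by simp
  qed
  then have "core_count t n x = 0" by (simp only: core_count_def card.empty)
  then show ?thesis unfolding if_not_P[OF False] .
qed

lemma sum_core_count_le:
  assumes "finite A"
  shows "(\<Sum>x\<in>A. core_count t n x) \<le> num_partitions n"
proof -
  have "(\<Sum>x\<in>A. core_count t n x)
      = card (\<Union>x\<in>A. {mu \<in> partitions_of n. core_vector t (3 * n) mu = x})"
    unfolding core_count_def using assms finite_partitions_of
    by (intro card_UN_disjoint[symmetric]) auto
  also have "\<dots> \<le> card (partitions_of n)" by (intro card_mono finite_partitions_of) auto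
  finally show ?thesis by (simp add: num_partitions_def)
qed

section \<open>Counts along lines in the lattice of core vectors\<close>

definition line :: "(nat \<Rightarrow> int) \<Rightarrow> (nat \<Rightarrow> int) \<Rightarrow> int \<Rightarrow> nat \<Rightarrow> int" where
  "line v x k = (\<lambda>r. x r + k * v r)"

lemma line_in_core_vectors:
  "x \<in> core_vectors t \<Longrightarrow> v \<in> core_vectors t \<Longrightarrow> line v x k \<in> core_vectors t"
  by (simp add: core_vectors_def line_def sum.distrib flip: sum_distrib_left)

lemma line_line: "line v (line v x k) l = line v x (k + l)"
  by (simp add: line_def fun_eq_iff algebra_simps)

text \<open>The conditions on \<open>v\<close> make the increment a multiple of
  \<open>2 * int t\<close>, so the congruence in \<open>core_count_eq\<close> is the same along the
  whole line.\<close>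

lemma core_form_line:
  assumes "(\<Sum>r<t. int r * v r) = int t * s" "(\<Sum>r<t. v r ^ 2) = 2 * \<alpha>"
  shows "core_form t (line v x k)
    = core_form t x + 2 * int t * (\<alpha> * k ^ 2 + ((\<Sum>r<t. x r * v r) + s) * k)"
proof -
  have "core_form t (line v x k) = (\<Sum>r<t. (int t * x r ^ 2 + 2 * int r * x r)
      + (int t * k ^ 2 * v r ^ 2 + (2 * int t * k * (x r * v r) + 2 * k * (int r * v r))))"
    unfolding core_form_def line_def
    by (intro sum.cong refl) (simp add: algebra_simps power2_eq_square)
  also have "\<dots> = core_form t x + (int t * k ^ 2 * (\<Sum>r<t. v r ^ 2)
      + (2 * int t * k * (\<Sum>r<t. x r * v r) + 2 * k * (\<Sum>r<t. int r * v r)))"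
    by (simp add: core_form_def sum.distrib sum_distrib_left)
  finally show ?thesis unfolding assms by (simp add: algebra_simps)
qed

text \<open>Along a line the core size is a convex quadratic polynomial, so the count is unimodal, and
  near its maximum it falls off at a rate independent of the line.\<close>

lemma line_profile:
  fixes n :: nat
  assumes t: "t > 0" and xv: "x \<in> core_vectors t" "v \<in> core_vectors t"
    and v: "(\<Sum>r<t. int r * v r) = int t * s" "(\<Sum>r<t. v r ^ 2) = 2 * \<alpha>" "\<alpha> > 0"
  defines "h \<equiv> \<lambda>k. core_count t n (line v x k)"
  shows "\<exists>k0. (\<forall>k\<ge>k0. h (k + 1) \<le> h k) \<and> (\<forall>k<k0. h k \<le> h (k + 1)) \<and>
    (h k0 > 0 \<longrightarrow> (\<exists>j. h k0 = multi_partitions t j \<and>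
      (\<forall>i m :: nat. \<alpha> * (int i ^ 2 + int i) \<le> int m \<and> m \<le> j \<longrightarrow>
        multi_partitions t (j - m) \<le> h (k0 + int i))))"
proof (cases "2 * int t dvd 2 * int n - core_form t x")
  case False
  have "\<not> 2 * int t dvd 2 * int n - core_form t (line v x k)" for k
  proof
    assume "2 * int t dvd 2 * int n - core_form t (line v x k)"
    then have "2 * int t dvd (2 * int n - core_form t (line v x k))
        + 2 * int t * (\<alpha> * k ^ 2 + ((\<Sum>r<t. x r * v r) + s) * k)"
      by (rule dvd_add) simp
    with False show False by (simp add: core_form_line[OF v(1,2)])
  qed
  then have "h k = 0" for k
    using core_count_eq[OF t line_in_core_vectors[OF xv]] by (simp add: h_def)
  then show ?thesis by simp
next
  case True
  then obtain d where d: "2 * int n - core_form t x = 2 * int t * d" by (auto elim: dvdE)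
  define b where "b = (\<Sum>r<t. x r * v r) + s"
  \<comment> \<open>\<open>q k\<close> is the would-be number of \<open>t\<close>-hooks at parameter
    \<open>k\<close>, and \<open>P\<close> extends \<open>multi_partitions t\<close> by 0 to
    negative arguments.\<close>
  define q where "q k = d - (\<alpha> * k ^ 2 + b * k)" for k
  define P where "P j = (if j \<ge> 0 then multi_partitions t (nat j) else 0)" for j :: int
  have eq: "2 * int n - core_form t (line v x k) = 2 * int t * q k" for k
    using d by (simp add: core_form_line[OF v(1,2)] q_def b_def algebra_simps)
  have le: "core_form t (line v x k) \<le> 2 * int n \<longleftrightarrow> q k \<ge> 0" for k
  proof -
    have "0 \<le> 2 * int t * q k \<longleftrightarrow> 0 \<le> q k" using t by (simp add: zero_le_mult_iff)
    then show ?thesis using eq[of k] by linarith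
  qed
  have h: "h k = P (q k)" for k
    unfolding h_def P_def core_count_eq[OF t line_in_core_vectors[OF xv]] le eq using t by simp
  have Pmono: "P i \<le> P j" if "i \<le> j" for i j
    using multi_partitions_mono[of "nat i" "nat j" "t - 1"] that t by (simp add: P_def nat_mono)
  \<comment> \<open>The integer nearest to the vertex \<open>- b / (2 * \<alpha>)\<close> of the
    concave polynomial \<open>q\<close>.\<close>
  define k0 where "k0 = (\<alpha> - b) div (2 * \<alpha>)"
  have "2 * \<alpha> * k0 + (\<alpha> - b) mod (2 * \<alpha>) = \<alpha> - b"
    unfolding k0_def by (rule mult_div_mod_eq)
  moreover have "0 \<le> (\<alpha> - b) mod (2 * \<alpha>)" "(\<alpha> - b) mod (2 * \<alpha>) < 2 * \<alpha>"
    using v(3) by simp_all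
  ultimately have k0: "2 * \<alpha> * k0 + b \<le> \<alpha>" "- \<alpha> \<le> 2 * \<alpha> * k0 + b" by linarith+
  have step: "q (k + 1) = q k - (2 * \<alpha> * k0 + b + \<alpha> + 2 * \<alpha> * (k - k0))" for k
    by (simp add: q_def algebra_simps power2_eq_square)
  have down: "h (k + 1) \<le> h k" if "k \<ge> k0" for k
  proof -
    have "0 \<le> 2 * \<alpha> * (k - k0)" using that v(3) by simp
    then show ?thesis unfolding h step using k0 by (intro Pmono) linarith
  qed
  have up: "h k \<le> h (k + 1)" if "k < k0" for k
  proof -
    have "2 * \<alpha> * (k - k0) \<le> 2 * \<alpha> * (- 1)" using that v(3) by (intro mult_left_mono) auto
    then show ?thesis unfolding h step using k0 by (intro Pmono) linarith
  qed
  have near: "\<exists>j. h k0 = multi_partitions t j \<and>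
      (\<forall>i m :: nat. \<alpha> * (int i ^ 2 + int i) \<le> int m \<and> m \<le> j \<longrightarrow>
        multi_partitions t (j - m) \<le> h (k0 + int i))" if "h k0 > 0"
  proof (intro exI[of _ "nat (q k0)"] conjI allI impI)
    have q0: "q k0 \<ge> 0" using that by (simp add: h P_def split: if_splits)
    then show "h k0 = multi_partitions t (nat (q k0))" by (simp add: h P_def)
    fix i m :: nat assume im: "\<alpha> * (int i ^ 2 + int i) \<le> int m \<and> m \<le> nat (q k0)"
    \<comment> \<open>Near the vertex the linear coefficient is at most \<open>\<alpha>\<close>, so
      \<open>i\<close> steps to the right lower \<open>q\<close> by at most
      \<open>\<alpha> * (i ^ 2 + i)\<close>, whatever the line.\<close>
    have "q (k0 + int i) = q k0 - (\<alpha> * int i ^ 2 + (2 * \<alpha> * k0 + b) * int i)"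
      by (simp add: q_def algebra_simps power2_eq_square)
    moreover have "(2 * \<alpha> * k0 + b) * int i \<le> \<alpha> * int i" using k0 by (intro mult_right_mono) auto
    ultimately have "q k0 - int m \<le> q (k0 + int i)" using im by (simp add: distrib_left)
    then have "P (q k0 - int m) \<le> h (k0 + int i)" unfolding h by (rule Pmono)
    moreover have "P (q k0 - int m) = multi_partitions t (nat (q k0) - m)"
    proof -
      have "int m \<le> q k0" using im q0 by linarith
      then show ?thesis by (simp add: P_def nat_diff_distrib)
    qed
    ultimately show "multi_partitions t (nat (q k0) - m) \<le> h (k0 + int i)" by simp
  qed
  show ?thesis by (rule exI[of _ k0], intro conjI allI impI) (rule down up near, assumption)+
qed

text \<open>The sum telescopes on either side of the peak.\<close>

lemma sum_abs_diff_unimodal: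
  fixes h :: "int \<Rightarrow> real"
  assumes "\<And>k. h k \<ge> 0" "\<And>k. k \<ge> k0 \<Longrightarrow> h (k + 1) \<le> h k" "\<And>k. k < k0 \<Longrightarrow> h k \<le> h (k + 1)"
    and "finite K"
  shows "(\<Sum>k\<in>K. \<bar>h k - h (k + 1)\<bar>) \<le> 2 * h k0"
proof -
  have right: "(\<Sum>k\<in>{k0..<k0 + int R}. \<bar>h k - h (k + 1)\<bar>) = h k0 - h (k0 + int R)" for R
  proof (induction R)
    case (Suc R)
    have "{k0..<k0 + int (Suc R)} = insert (k0 + int R) {k0..<k0 + int R}" by auto
    then show ?case using Suc assms(2)[of "k0 + int R"] by (simp add: algebra_simps)
  qed simp
  have left: "(\<Sum>k\<in>{k0 - int R..<k0}. \<bar>h k - h (k + 1)\<bar>) = h k0 - h (k0 - int R)" for R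
  proof (induction R)
    case (Suc R)
    have "{k0 - int (Suc R)..<k0} = insert (k0 - int R - 1) {k0 - int R..<k0}" by auto
    then show ?case using Suc assms(3)[of "k0 - int R - 1"] by (simp add: algebra_simps)
  qed simp
  obtain R where R: "K \<subseteq> {k0 - int R..<k0 + int R}"
  proof -
    define R where "R = (\<Sum>k\<in>K. nat \<bar>k - k0\<bar> + 1)"
    have "nat \<bar>k - k0\<bar> + 1 \<le> R" if "k \<in> K" for k
      unfolding R_def using assms(4) that by (intro member_le_sum) auto
    then have "K \<subseteq> {k0 - int R..<k0 + int R}" by fastforce
    then show ?thesis by (rule that)
  qed
  have "(\<Sum>k\<in>K. \<bar>h k - h (k + 1)\<bar>) \<le> (\<Sum>k\<in>{k0 - int R..<k0 + int R}. \<bar>h k - h (k + 1)\<bar>)"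
    using R by (intro sum_mono2) auto
  also have "{k0 - int R..<k0 + int R} = {k0 - int R..<k0} \<union> {k0..<k0 + int R}" by auto
  also have "(\<Sum>k\<in>\<dots>. \<bar>h k - h (k + 1)\<bar>) = (h k0 - h (k0 - int R)) + (h k0 - h (k0 + int R))"
    unfolding right[symmetric] left[symmetric] by (rule sum.union_disjoint) auto
  also have "\<dots> \<le> 2 * h k0" using assms(1)[of "k0 - int R"] assms(1)[of "k0 + int R"] by simp
  finally show ?thesis .
qed

text \<open>A square has the parity of its base, and the entries sum to 0.\<close>

lemma even_sum_squares:
  assumes "v \<in> core_vectors t"
  shows "even (\<Sum>r<t. v r ^ 2)"
proof -
  have "even (\<Sum>r<t. v r ^ 2 - v r)" by (intro dvd_sum) simp
  then show ?thesis using assms by (simp add: core_vectors_def sum_subtractf)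
qed

lemma card_core_vectors_bounded:
  assumes "finite Z" "Z \<subseteq> core_vectors t" "\<And>z r. z \<in> Z \<Longrightarrow> r < t \<Longrightarrow> \<bar>z r\<bar> \<le> int m"
  shows "card Z \<le> (2 * m + 1) ^ t"
proof -
  have "inj_on (\<lambda>z. \<lambda>r\<in>{..<t}. z r) Z"
  proof (rule inj_onI)
    fix x y assume xy: "x \<in> Z" "y \<in> Z" "(\<lambda>r\<in>{..<t}. x r) = (\<lambda>r\<in>{..<t}. y r)"
    have "x r = y r" for r
    proof (cases "r < t")
      case True
      then show ?thesis using fun_cong[OF xy(3), of r] by simp
    next
      case False
      then have "r \<ge> t" by simp
      moreover have "x \<in> core_vectors t" "y \<in> core_vectors t" using xy assms(2) by auto
      ultimately show ?thesis by (simp add: core_vectors_def)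
    qed
    then show "x = y" by blast
  qed
  moreover have "(\<lambda>z. \<lambda>r\<in>{..<t}. z r) ` Z \<subseteq> PiE {..<t} (\<lambda>_. {- int m..int m})"
  proof (intro image_subsetI restrict_PiE_iff[THEN iffD2] ballI)
    fix z r assume "z \<in> Z" "r \<in> {..<t}"
    then show "z r \<in> {- int m..int m}" using assms(3)[of z r] by (simp add: abs_le_iff)
  qed
  ultimately have "card Z \<le> card (PiE {..<t} (\<lambda>_. {- int m..int m}))"
    by (rule card_inj_on_le) (auto intro!: finite_PiE)
  also have "\<dots> = (2 * m + 1) ^ t" by (simp add: card_PiE nat_add_distrib nat_mult_distrib)
  finally show ?thesis .
qed


text \<open>Points whose entry \<open>a\<close> lies between 0 and \<open>v a - 1\<close> represent
  the lines in direction \<open>v\<close>; the parameter is recovered by division.\<close>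

lemma line_coord: "v a > 0 \<Longrightarrow> 0 \<le> y a \<Longrightarrow> y a < v a \<Longrightarrow> line v y k a div v a = k"
  by (simp add: line_def)

lemma line_0: "line v x 0 = x"
  by (simp add: line_def)

text \<open>Grouping \<open>A\<close> by lines, with \<open>Y\<close> the set of representatives,
  bounds each group by the total variation along its line.\<close>

lemma sum_abs_shift_le:
  fixes W :: "(nat \<Rightarrow> int) \<Rightarrow> nat"
  assumes va: "v a > 0" and "finite A"
    and peak: "\<And>y. y \<in> Y \<Longrightarrow> (\<forall>k\<ge>k0 y. W (line v y (k + 1)) \<le> W (line v y k)) \<and>
      (\<forall>k<k0 y. W (line v y k) \<le> W (line v y (k + 1)))"
    and Y: "Y = (\<lambda>x. line v x (- (x a div v a))) ` A"
  shows "(\<Sum>x\<in>A. \<bar>real (W x) - real (W (line v x 1))\<bar>) \<le> (\<Sum>y\<in>Y. 2 * real (W (line v y (k0 y))))"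
proof -
  let ?p = "\<lambda>x. line v x (- (x a div v a))"
  have "(\<Sum>x\<in>A. \<bar>real (W x) - real (W (line v x 1))\<bar>)
      = (\<Sum>y\<in>Y. \<Sum>x\<in>{x \<in> A. ?p x = y}. \<bar>real (W x) - real (W (line v x 1))\<bar>)"
    unfolding Y by (rule sum.image_gen[OF \<open>finite A\<close>])
  also have "\<dots> \<le> (\<Sum>y\<in>Y. 2 * real (W (line v y (k0 y))))"
  proof (rule sum_mono)
    fix y assume y: "y \<in> Y"
    let ?F = "{x \<in> A. ?p x = y}"
    have coord: "x = line v y (x a div v a)" if "x \<in> ?F" for x
    proof -
      from that have "line v y (x a div v a) = line v (?p x) (x a div v a)" by simp
      also have "\<dots> = x" unfolding line_line by (simp add: line_def)
      finally show ?thesis by simp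
    qed
    have inj: "inj_on (\<lambda>x. x a div v a) ?F"
      by (rule inj_onI) (metis (no_types, lifting) coord)
    let ?h = "\<lambda>k. real (W (line v y k))"
    have "(\<Sum>x\<in>?F. \<bar>real (W x) - real (W (line v x 1))\<bar>)
        = (\<Sum>x\<in>?F. \<bar>?h (x a div v a) - ?h (x a div v a + 1)\<bar>)"
    proof (rule sum.cong[OF refl])
      fix x assume x: "x \<in> ?F"
      have "line v x 1 = line v y (x a div v a + 1)"
        using arg_cong[OF coord[OF x], of "\<lambda>z. line v z 1"] by (simp add: line_line)
      with coord[OF x] show "\<bar>real (W x) - real (W (line v x 1))\<bar>
          = \<bar>?h (x a div v a) - ?h (x a div v a + 1)\<bar>" by simp
    qed
    also have "\<dots> = (\<Sum>k\<in>(\<lambda>x. x a div v a) ` ?F. \<bar>?h k - ?h (k + 1)\<bar>)"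
      by (simp add: sum.reindex[OF inj])
    also have "\<dots> \<le> 2 * ?h (k0 y)"
      using peak[OF y] \<open>finite A\<close> by (intro sum_abs_diff_unimodal) auto
    finally show "(\<Sum>x\<in>?F. \<bar>real (W x) - real (W (line v x 1))\<bar>) \<le> 2 * real (W (line v y (k0 y)))"
      by simp
  qed
  finally show ?thesis .
qed

text \<open>It suffices to bound the sum of the peaks over all lines. A high peak is, up to the
  factor \<open>c\<close>, matched by \<open>I\<close> points of its line, and the total mass is at
  most \<open>num_partitions n\<close>. The low peaks are bounded by a constant and polynomially
  many.\<close>

lemma core_count_shift:
  assumes t: "t > 0" and v: "v \<in> core_vectors t" "int t dvd (\<Sum>r<t. int r * v r)"
    and a: "a < t" "v a > 0" and "\<epsilon> > 0"
  shows "\<forall>\<^sub>F n in sequentially. \<forall>A. finite A \<and> A \<subseteq> core_vectors t \<longrightarrow>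
    (\<Sum>x\<in>A. \<bar>real (core_count t n x) - real (core_count t n (line v x 1))\<bar>)
      \<le> \<epsilon> * real (num_partitions n)"
proof -
  obtain s where s: "(\<Sum>r<t. int r * v r) = int t * s" using v(2) by (auto elim: dvdE)
  obtain \<alpha> where \<alpha>: "(\<Sum>r<t. v r ^ 2) = 2 * \<alpha>"
    using even_sum_squares[OF v(1)] by (auto elim: evenE)
  have "v a ^ 2 \<le> (\<Sum>r<t. v r ^ 2)" using a by (intro member_le_sum) auto
  then have \<alpha>0: "\<alpha> > 0" using a \<alpha> zero_less_power[of "v a" 2] by linarith
  let ?P = "multi_partitions t"
  have "slowly_growing ?P" using slowly_growing_multi_partitions[of "t - 1"] t by simp
  then obtain c where c: "\<And>k. \<forall>\<^sub>F n in sequentially. ?P (n + k) \<le> c * ?P n"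
    unfolding slowly_growing_def by blast
  \<comment> \<open>Peaks enter with a factor 2, so high and low peaks may each sum to
    \<open>\<epsilon> / 4\<close> times \<open>num_partitions n\<close>.\<close>
  obtain I :: nat where I: "real I > 4 * real c / \<epsilon>" using reals_Archimedean2 by blast
  then have "I > 0" using \<open>\<epsilon> > 0\<close> by (cases I) (auto simp: field_simps)
  \<comment> \<open>\<open>m\<close> bounds the loss of \<open>t\<close>-hooks over the first
    \<open>I\<close> steps from a peak. \<open>D\<close> bounds every peak whose index is too small
    for slow growth with shift \<open>m\<close>.\<close>
  define m where "m = nat (\<alpha> * (int I ^ 2 + int I))"
  obtain J where J: "\<And>n. n \<ge> J \<Longrightarrow> ?P (n + m) \<le> c * ?P n"
    using c[of m] by (auto simp: eventually_sequentially)
  define D where "D = ?P (J + m)"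
  obtain L :: nat where L: "real L > 4 * real (D * 4 ^ t) / \<epsilon>" using reals_Archimedean2 by blast
  show ?thesis using num_partitions_superpolynomial[of L t]
  proof eventually_elim
    case (elim n)
    show ?case
    proof (intro allI impI, elim conjE)
      fix A :: "(nat \<Rightarrow> int) set" assume A: "finite A" "A \<subseteq> core_vectors t"
      define Y where "Y = (\<lambda>x. line v x (- (x a div v a))) ` A"
      let ?W = "core_count t n"
      have Y: "finite Y" "Y \<subseteq> core_vectors t"
        using A line_in_core_vectors[OF _ v(1)] by (auto simp: Y_def)
      have Ya: "0 \<le> y a \<and> y a < v a" if "y \<in> Y" for y
      proof -
        have "z + (- (z div v a)) * v a = z mod v a" for z
          using div_mult_mod_eq[of z "v a"] by linarith
        with that a(2) show ?thesis by (auto simp: Y_def line_def)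
      qed
      let ?peak = "\<lambda>y k0. (\<forall>k\<ge>k0. ?W (line v y (k + 1)) \<le> ?W (line v y k)) \<and>
        (\<forall>k<k0. ?W (line v y k) \<le> ?W (line v y (k + 1)))"
      let ?near = "\<lambda>y k0. ?W (line v y k0) > 0 \<longrightarrow> (\<exists>j. ?W (line v y k0) = ?P j \<and>
          (\<forall>i m :: nat. \<alpha> * (int i ^ 2 + int i) \<le> int m \<and> m \<le> j \<longrightarrow>
            ?P (j - m) \<le> ?W (line v y (k0 + int i))))"
      have "\<forall>y\<in>Y. \<exists>k0. ?peak y k0 \<and> ?near y k0"
      proof
        fix y assume "y \<in> Y"
        with Y(2) have "y \<in> core_vectors t" by auto
        from line_profile[OF t this v(1) s \<alpha> \<alpha>0, of n]
        show "\<exists>k0. ?peak y k0 \<and> ?near y k0" by (simp only: conj_assoc)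
      qed
      from bchoice[OF this] obtain k0 where k0: "\<forall>y\<in>Y. ?peak y (k0 y) \<and> ?near y (k0 y)" ..
      have peak: "?peak y (k0 y)" if "y \<in> Y" for y
        by (rule conjunct1[OF bspec[OF k0 that]])
      have near: "?near y (k0 y)" if "y \<in> Y" for y
        by (rule conjunct2[OF bspec[OF k0 that]])
      define w where "w y = ?W (line v y (k0 y))" for y
      define Y1 where "Y1 = {y \<in> Y. I * w y \<le> c * (\<Sum>i<I. ?W (line v y (k0 y + int i)))}"
      \<comment> \<open>Distinct representatives give disjoint lines, so the points collected near
        different peaks do not overlap.\<close>
      have eq: "y = y' \<and> k = l"
        if "y \<in> Y" "y' \<in> Y" "line v y k = line v y' l" for y y' k l
      proof -
        have "k = line v y k a div v a" using Ya[OF that(1)] a(2) by (simp add: line_coord)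
        also have "\<dots> = line v y' l a div v a" by (simp only: that(3))
        also have "\<dots> = l" using Ya[OF that(2)] a(2) by (simp add: line_coord)
        finally have kl: "k = l" .
        have "y = line v (line v y k) (- k)" by (simp add: line_line line_0)
        also have "\<dots> = line v (line v y' l) (- l)" unfolding that(3) by (simp only: kl)
        also have "\<dots> = y'" by (simp add: line_line line_0)
        finally show ?thesis using kl by simp
      qed
      have small: "w y \<le> D" if "y \<in> Y - Y1" for y
      proof (cases "w y > 0")
        case True
        with near[of y] that obtain j where j: "w y = ?P j" and
          im: "\<And>i m :: nat. \<alpha> * (int i ^ 2 + int i) \<le> int m \<and> m \<le> j \<Longrightarrow>
            ?P (j - m) \<le> ?W (line v y (k0 y + int i))"
          unfolding w_def by blast
        have "j < J + m"
        proof (rule ccontr)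
          assume "\<not> j < J + m"
          then have jm: "J + m \<le> j" by simp
          have "?P j \<le> c * ?W (line v y (k0 y + int i))" if "i < I" for i
          proof -
            have "int i ^ 2 + int i \<le> int I ^ 2 + int I"
              using that by (intro add_mono power_mono) auto
            then have "\<alpha> * (int i ^ 2 + int i) \<le> int m"
              using \<alpha>0 by (simp add: m_def)
            then have "?P (j - m) \<le> ?W (line v y (k0 y + int i))" using jm by (intro im) simp
            then have "c * ?P (j - m) \<le> c * ?W (line v y (k0 y + int i))" by (rule mult_le_mono2)
            moreover have "?P j \<le> c * ?P (j - m)" using J[of "j - m"] jm by simp
            ultimately show ?thesis by (rule order_trans[rotated])
          qed
          then have "(\<Sum>i<I. ?P j) \<le> (\<Sum>i<I. c * ?W (line v y (k0 y + int i)))"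
            by (intro sum_mono) auto
          then have "y \<in> Y1" using that by (simp add: Y1_def j sum_distrib_left)
          with that show False by simp
        qed
        then show ?thesis
          unfolding j D_def using multi_partitions_mono[of j "J + m" "t - 1"] t by simp
      qed simp
      have "I * (\<Sum>y\<in>Y1. w y) \<le> (\<Sum>y\<in>Y1. c * (\<Sum>i<I. ?W (line v y (k0 y + int i))))"
        unfolding sum_distrib_left by (intro sum_mono) (auto simp: Y1_def sum_distrib_left)
      also have "\<dots> = c * (\<Sum>(y, i)\<in>Y1 \<times> {..<I}. ?W (line v y (k0 y + int i)))"
        by (simp add: sum.cartesian_product flip: sum_distrib_left)
      also have "(\<Sum>(y, i)\<in>Y1 \<times> {..<I}. ?W (line v y (k0 y + int i)))
          = (\<Sum>x\<in>(\<lambda>(y, i). line v y (k0 y + int i)) ` (Y1 \<times> {..<I}). ?W x)"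
      proof -
        have "inj_on (\<lambda>(y, i). line v y (k0 y + int i)) (Y1 \<times> {..<I})"
        proof (rule inj_onI, clarify)
          fix y i y' i' assume "y \<in> Y1" "y' \<in> Y1"
            "line v y (k0 y + int i) = line v y' (k0 y' + int i')"
          then have "y = y' \<and> k0 y + int i = k0 y' + int i'" by (intro eq) (auto simp: Y1_def)
          then show "y = y' \<and> i = i'" by auto
        qed
        then show ?thesis by (simp add: sum.reindex case_prod_unfold)
      qed
      also have "\<dots> \<le> num_partitions n"
        using Y by (intro sum_core_count_le) (auto simp: Y1_def)
      finally have "I * (\<Sum>y\<in>Y1. w y) \<le> c * num_partitions n" by simp
      then have "real (I * (\<Sum>y\<in>Y1. w y)) \<le> real (c * num_partitions n)" by (simp only: of_nat_le_iff)
      then have "real I * real (\<Sum>y\<in>Y1. w y) \<le> real c * real (num_partitions n)" by simp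
      also have "\<dots> \<le> (real I * \<epsilon> / 4) * real (num_partitions n)"
        using I \<open>\<epsilon> > 0\<close> by (intro mult_right_mono) (simp_all add: field_simps)
      finally have big: "real (\<Sum>y\<in>Y1. w y) \<le> \<epsilon> / 4 * real (num_partitions n)"
        using \<open>I > 0\<close> by (simp add: field_simps)
      \<comment> \<open>A peak with positive count has \<open>core_form\<close> at most
        \<open>2 * n\<close>, hence lies in a box of side polynomial in \<open>n\<close>.\<close>
      define Y2 where "Y2 = {y \<in> Y - Y1. w y > 0}"
      have "card Y2 = card ((\<lambda>y. line v y (k0 y)) ` Y2)"
        using eq by (intro card_image[symmetric] inj_onI) (auto simp: Y2_def)
      also have "\<dots> \<le> (2 * (2 * n) + 1) ^ t"
      proof (rule card_core_vectors_bounded)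
        show "finite ((\<lambda>y. line v y (k0 y)) ` Y2)" using Y by (simp add: Y2_def)
        show sub: "(\<lambda>y. line v y (k0 y)) ` Y2 \<subseteq> core_vectors t"
          using Y line_in_core_vectors[OF _ v(1)] by (auto simp: Y2_def)
        fix z r assume z: "z \<in> (\<lambda>y. line v y (k0 y)) ` Y2" and r: "r < t"
        then have "?W z > 0" by (auto simp: Y2_def w_def)
        then have "core_form t z \<le> 2 * int n"
          using core_count_eq[OF t, of z n] z sub by (auto split: if_splits)
        then show "\<bar>z r\<bar> \<le> int (2 * n)" using abs_core_vector_le[of z t r] z sub r by auto
      qed
      also have "\<dots> \<le> (4 * (n + 1)) ^ t" by (intro power_mono) auto
      finally have cardY2: "card Y2 \<le> 4 ^ t * (n + 1) ^ t" by (simp only: power_mult_distrib)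
      have "(\<Sum>y\<in>Y - Y1. w y) = (\<Sum>y\<in>Y2. w y)"
        using Y by (intro sum.mono_neutral_right) (auto simp: Y2_def)
      also have "\<dots> \<le> (\<Sum>y\<in>Y2. D)" using small by (intro sum_mono) (auto simp: Y2_def)
      also have "\<dots> \<le> (4 ^ t * (n + 1) ^ t) * D" using cardY2 by simp
      finally have "real (\<Sum>y\<in>Y - Y1. w y) \<le> real ((4 ^ t * (n + 1) ^ t) * D)"
        by (simp only: of_nat_le_iff)
      also have "\<dots> = real (D * 4 ^ t) * real ((n + 1) ^ t)" by simp
      also have "\<dots> \<le> (\<epsilon> / 4 * real L) * real ((n + 1) ^ t)"
        using L \<open>\<epsilon> > 0\<close> by (intro mult_right_mono) (simp_all add: field_simps)
      also have "\<dots> = \<epsilon> / 4 * real (L * (n + 1) ^ t)" by simp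
      also have "\<dots> \<le> \<epsilon> / 4 * real (num_partitions n)"
        using elim[folded of_nat_le_iff[where 'a = real]] \<open>\<epsilon> > 0\<close> by (intro mult_left_mono) auto
      finally have rest: "real (\<Sum>y\<in>Y - Y1. w y) \<le> \<epsilon> / 4 * real (num_partitions n)" .
      have "(\<Sum>x\<in>A. \<bar>real (?W x) - real (?W (line v x 1))\<bar>) \<le> (\<Sum>y\<in>Y. 2 * real (w y))"
        unfolding w_def using peak Y_def by (intro sum_abs_shift_le[where v = v and a = a, OF a(2) A(1)])
      also have "\<dots> = 2 * (real (\<Sum>y\<in>Y - Y1. w y) + real (\<Sum>y\<in>Y1. w y))"
        using sum.subset_diff[of Y1 Y w] Y by (simp add: Y1_def flip: sum_distrib_left of_nat_sum)
      also have "\<dots> \<le> \<epsilon> * real (num_partitions n)" using big rest by simp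
      finally show "(\<Sum>x\<in>A. \<bar>real (?W x) - real (?W (line v x 1))\<bar>)
        \<le> \<epsilon> * real (num_partitions n)" .
    qed
  qed
qed

section \<open>Averages over core vectors\<close>

definition core_support :: "nat \<Rightarrow> nat \<Rightarrow> (nat \<Rightarrow> int) set" where
  "core_support t n = core_vector t (3 * n) ` partitions_of n"

lemma finite_core_support: "finite (core_support t n)"
  by (simp add: core_support_def finite_partitions_of)

lemma core_support_subset: "t > 0 \<Longrightarrow> core_support t n \<subseteq> core_vectors t"
  using core_vector_in by (auto simp: core_support_def)

lemma core_count_eq_0: "x \<notin> core_support t n \<Longrightarrow> core_count t n x = 0"
  using finite_partitions_of[of n] by (auto simp: core_support_def core_count_def)

lemma sum_partitions_by_core:
  fixes f :: "(nat \<Rightarrow> int) \<Rightarrow> real"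
  shows "(\<Sum>mu\<in>partitions_of n. f (core_vector t (3 * n) mu))
    = (\<Sum>x\<in>core_support t n. f x * real (core_count t n x))"
proof -
  have "(\<Sum>mu\<in>partitions_of n. f (core_vector t (3 * n) mu))
      = (\<Sum>x\<in>core_support t n. \<Sum>mu\<in>{mu \<in> partitions_of n. core_vector t (3 * n) mu = x}.
          f (core_vector t (3 * n) mu))"
    unfolding core_support_def by (rule sum.image_gen[OF finite_partitions_of])
  also have "\<dots> = (\<Sum>x\<in>core_support t n. f x * real (core_count t n x))"
    by (intro sum.cong refl) (simp add: core_count_def)
  finally show ?thesis .
qed

lemma sum_core_count: "(\<Sum>x\<in>core_support t n. real (core_count t n x)) = real (num_partitions n)"
  using sum_partitions_by_core[of "\<lambda>_. 1" t n] by (simp add: num_partitions_def)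

text \<open>Reindexing the sum moves the translation from \<open>f\<close> to the weights. The bound
  is uniform in \<open>f\<close>, so \<open>f\<close> may depend on \<open>n\<close>.\<close>

lemma core_average_shift:
  assumes t: "t > 0" and v: "v \<in> core_vectors t" "int t dvd (\<Sum>r<t. int r * v r)"
    and a: "a < t" "v a > 0" and "\<epsilon> > 0"
  shows "\<forall>\<^sub>F n in sequentially. \<forall>f. (\<forall>x. \<bar>f x\<bar> \<le> 1) \<longrightarrow>
    \<bar>(\<Sum>x\<in>core_support t n. (f x - f (line v x 1)) * real (core_count t n x))\<bar>
      \<le> \<epsilon> * real (num_partitions n)"
  using core_count_shift[OF assms]
proof eventually_elim
  case (elim n)
  show ?case
  proof (intro allI impI)
    fix f :: "(nat \<Rightarrow> int) \<Rightarrow> real" assume f: "\<forall>x. \<bar>f x\<bar> \<le> 1"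
    let ?X = "core_support t n" and ?s = "\<lambda>x. line v x 1"
    let ?W = "\<lambda>x. real (core_count t n x)"
    \<comment> \<open>Adding the translate by \<open>- v\<close> lets one index set carry both the
      weights and the shifted weights.\<close>
    define A where "A = ?X \<union> (\<lambda>x. line v x (- 1)) ` ?X"
    have A: "finite A" "A \<subseteq> core_vectors t"
      using finite_core_support subsetD[OF core_support_subset[OF t]] line_in_core_vectors[OF _ v(1)]
      by (auto simp: A_def)
    have inj: "inj_on ?s A"
    proof (rule inj_onI)
      fix x y assume "line v x 1 = line v y 1"
      from arg_cong[OF this, of "\<lambda>z. line v z (- 1)"] show "x = y" by (simp add: line_line line_0)
    qed
    have sub: "?X \<subseteq> ?s ` A"
    proof
      fix x assume x: "x \<in> ?X"
      show "x \<in> ?s ` A"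
        by (rule image_eqI[of _ _ "line v x (- 1)"]) (use x in \<open>simp_all add: A_def line_line line_0\<close>)
    qed
    have "(\<Sum>x\<in>?X. f x * ?W x) = (\<Sum>x\<in>?s ` A. f x * ?W x)"
      using A sub by (intro sum.mono_neutral_left) (auto simp: core_count_eq_0)
    also have "\<dots> = (\<Sum>x\<in>A. f (?s x) * ?W (?s x))" by (simp add: sum.reindex[OF inj])
    finally have 1: "(\<Sum>x\<in>?X. f x * ?W x) = (\<Sum>x\<in>A. f (?s x) * ?W (?s x))" .
    have 2: "(\<Sum>x\<in>?X. f (?s x) * ?W x) = (\<Sum>x\<in>A. f (?s x) * ?W x)"
      using A by (intro sum.mono_neutral_left) (auto simp: core_count_eq_0 A_def)
    have "(\<Sum>x\<in>?X. (f x - f (?s x)) * ?W x) = (\<Sum>x\<in>A. f (?s x) * (?W (?s x) - ?W x))"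
      by (simp add: left_diff_distrib right_diff_distrib sum_subtractf 1 2)
    also have "\<bar>\<dots>\<bar> \<le> (\<Sum>x\<in>A. \<bar>f (?s x) * (?W (?s x) - ?W x)\<bar>)" by (rule sum_abs)
    also have "\<dots> \<le> (\<Sum>x\<in>A. \<bar>?W x - ?W (?s x)\<bar>)"
    proof (rule sum_mono)
      fix x
      show "\<bar>f (?s x) * (?W (?s x) - ?W x)\<bar> \<le> \<bar>?W x - ?W (?s x)\<bar>"
        using f mult_left_le_one_le[of "\<bar>?W x - ?W (?s x)\<bar>" "\<bar>f (?s x)\<bar>"]
        by (simp add: abs_mult abs_minus_commute)
    qed
    also have "\<dots> \<le> \<epsilon> * real (num_partitions n)" using elim A by blast
    finally show "\<bar>(\<Sum>x\<in>?X. (f x - f (?s x)) * ?W x)\<bar> \<le> \<epsilon> * real (num_partitions n)" .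
  qed
qed

section \<open>The parity of the number of hooks\<close>

definition parity_bias :: "nat \<Rightarrow> nat \<Rightarrow> real" where
  "parity_bias t n = (real (p_even t n) - real (p_odd t n)) / real (num_partitions n)"

definition par :: "int \<Rightarrow> real" where
  "par k = (if even k then 1 else - 1)"

lemma abs_par: "\<bar>par k\<bar> = 1"
  by (simp add: par_def)

lemma p_even_plus_p_odd: "p_even t n + p_odd t n = num_partitions n"
proof -
  have "partitions_of n = {mu \<in> partitions_of n. even (size (t_hooks t mu))}
      \<union> {mu \<in> partitions_of n. odd (size (t_hooks t mu))}" by auto
  then show ?thesis
    unfolding num_partitions_def p_even_def p_odd_def
    by (subst (3) \<open>partitions_of n = _\<close>, subst card_Un_disjoint) (auto simp: finite_partitions_of)
qed

lemma delta_eq_parity_bias: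
  "delta_even t n = 1 / 2 + parity_bias t n / 2" "delta_odd t n = 1 / 2 - parity_bias t n / 2"
proof -
  have "real (p_even t n) + real (p_odd t n) = real (num_partitions n)"
    using p_even_plus_p_odd[of t n] by (metis of_nat_add)
  then show "delta_even t n = 1 / 2 + parity_bias t n / 2" "delta_odd t n = 1 / 2 - parity_bias t n / 2"
    using num_partitions_pos[of n]
    by (simp_all add: delta_even_def delta_odd_def parity_bias_def field_simps)
qed

lemma parity_bias_sum:
  "parity_bias t n * real (num_partitions n)
    = (\<Sum>mu\<in>partitions_of n. par (int (size (t_hooks t mu))))"
proof -
  let ?E = "{mu \<in> partitions_of n. even (size (t_hooks t mu))}"
  let ?O = "{mu \<in> partitions_of n. odd (size (t_hooks t mu))}"
  have "(\<Sum>mu\<in>partitions_of n. par (int (size (t_hooks t mu))))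
      = (\<Sum>mu\<in>?E \<union> ?O. par (int (size (t_hooks t mu))))" by (intro sum.cong) auto
  also have "\<dots> = (\<Sum>mu\<in>?E. par (int (size (t_hooks t mu)))) + (\<Sum>mu\<in>?O. par (int (size (t_hooks t mu))))"
    by (rule sum.union_disjoint) (auto simp: finite_partitions_of)
  also have "\<dots> = (\<Sum>mu\<in>?E. 1) + (\<Sum>mu\<in>?O. - 1)" by (simp add: par_def)
  finally show ?thesis using num_partitions_pos[of n]
    by (simp add: parity_bias_def p_even_def p_odd_def)
qed

text \<open>For t = 2h, the translation by 2 at runner h and -2 at runner 0 changes the number of
  \<open>t\<close>-hooks by an odd amount: in \<open>core_form_line\<close> both
  \<open>\<alpha> = 4\<close> and the scalar product with \<open>v\<close> are even, while
  \<open>s = 1\<close>. The sign is reversed, so its average tends to 0.\<close>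

lemma parity_bias_even:
  assumes "even t" "t > 0"
  shows "parity_bias t \<longlonglongrightarrow> 0"
proof -
  obtain h where h: "t = 2 * h" using assms(1) by (elim evenE)
  then have "h > 0" "h < t" using assms(2) by simp_all
  define v where "v r = (if r = h then 2 else 0) - (if r = 0 then 2 else 0 :: int)" for r
  have delta: "(\<Sum>r<t. if r = k then c else 0) = c" if "k < t" for k and c :: int
    using that by simp
  have v: "v \<in> core_vectors t"
    using \<open>h < t\<close> assms(2) delta[of h 2] delta[of 0 2]
    by (auto simp: v_def core_vectors_def sum_subtractf)
  have "(\<Sum>r<t. int r * v r) = (\<Sum>r<t. if r = h then 2 * int h else 0)"
    by (intro sum.cong) (auto simp: v_def)
  then have rv: "(\<Sum>r<t. int r * v r) = int t * 1" using delta[OF \<open>h < t\<close>] h by simp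
  have "(\<Sum>r<t. v r ^ 2) = (\<Sum>r<t. (if r = h then 4 else 0) + (if r = 0 then 4 else 0))"
    using \<open>h > 0\<close> by (intro sum.cong) (auto simp: v_def)
  then have vv: "(\<Sum>r<t. v r ^ 2) = 2 * 4"
    using delta[OF \<open>h < t\<close>] delta[OF assms(2)] by (simp only: sum.distrib)
  define f where "f n x = par ((2 * int n - core_form t x) div (2 * int t))" for n x
  have hooks: "par (int (size (t_hooks t mu))) = f n (core_vector t (3 * n) mu)"
    and dvd: "2 * int t dvd 2 * int n - core_form t (core_vector t (3 * n) mu)"
    if "mu \<in> partitions_of n" for mu n
  proof -
    have "n \<le> t * (3 * n)" using assms(2) by (cases t) auto
    from size_t_hooks_core[OF assms(2) this that]
    have *: "2 * int n - core_form t (core_vector t (3 * n) mu) = 2 * int t * int (size (t_hooks t mu))"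
      by simp
    then show "par (int (size (t_hooks t mu))) = f n (core_vector t (3 * n) mu)"
      using assms(2) by (simp add: f_def)
    show "2 * int t dvd 2 * int n - core_form t (core_vector t (3 * n) mu)" unfolding * by simp
  qed
  have flip: "f n (line v x 1) = - f n x" if "x \<in> core_support t n" for n x
  proof -
    have "2 * int t dvd 2 * int n - core_form t x"
      using that dvd by (auto simp: core_support_def)
    then obtain d where d: "2 * int n - core_form t x = 2 * int t * d" by (elim dvdE)
    have "(\<Sum>r<t. x r * v r) = 2 * (\<Sum>r<t. x r * (v r div 2))"
      unfolding sum_distrib_left by (intro sum.cong) (auto simp: v_def)
    then have "2 * int n - core_form t (line v x 1)
        = 2 * int t * (d - 2 * (2 + (\<Sum>r<t. x r * (v r div 2))) - 1)"
      using d by (simp add: core_form_line[OF rv vv] algebra_simps)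
    then show ?thesis using d assms(2) by (simp add: f_def par_def)
  qed
  have va: "v h > 0" using \<open>h > 0\<close> by (simp add: v_def)
  show ?thesis
  proof (rule tendstoI)
    fix \<epsilon> :: real assume "\<epsilon> > 0"
    then have "\<forall>\<^sub>F n in sequentially. \<forall>f. (\<forall>x. \<bar>f x\<bar> \<le> 1) \<longrightarrow>
      \<bar>(\<Sum>x\<in>core_support t n. (f x - f (line v x 1)) * real (core_count t n x))\<bar>
        \<le> \<epsilon> * real (num_partitions n)"
      using rv by (intro core_average_shift[OF assms(2) v _ \<open>h < t\<close> va]) auto
    then show "\<forall>\<^sub>F n in sequentially. dist (parity_bias t n) 0 < \<epsilon>"
    proof eventually_elim
      case (elim n)
      have "(\<Sum>x\<in>core_support t n. (f n x - f n (line v x 1)) * real (core_count t n x))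
          = 2 * (\<Sum>x\<in>core_support t n. f n x * real (core_count t n x))"
        unfolding sum_distrib_left by (intro sum.cong) (auto simp: flip)
      also have "\<dots> = 2 * (parity_bias t n * real (num_partitions n))"
        unfolding parity_bias_sum sum_partitions_by_core[symmetric] by (simp add: hooks)
      finally have "2 * \<bar>parity_bias t n\<bar> * real (num_partitions n) \<le> \<epsilon> * real (num_partitions n)"
        using elim[rule_format, of "f n"] by (simp add: f_def abs_par abs_mult)
      then have "2 * \<bar>parity_bias t n\<bar> \<le> \<epsilon>" using num_partitions_pos[of n] by simp
      then show ?case using \<open>\<epsilon> > 0\<close> by simp
    qed
  qed
qed

section \<open>The sign of the core size as a product over the runners\<close>

lemma i_powi_4: "\<i> powi (4 * k) = 1"
proof -
  have "\<i> powi (4 * k) = (\<i> powi 4) powi k" by (rule power_int_mult)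
  also have "\<i> powi 4 = 1" by (simp add: power_int_numeral eval_nat_numeral)
  finally show ?thesis by simp
qed

text \<open>Modulo 4 the exponent is 0 for even \<open>y\<close> and \<open>t + 2 * r\<close> for
  odd \<open>y\<close>.\<close>

lemma i_powi_term:
  "\<i> powi (int t * y ^ 2 + 2 * int r * y) = (if even y then 1 else \<i> ^ t * (- 1) ^ r)"
proof (cases "even y")
  case True
  then obtain m where "y = 2 * m" by (elim evenE)
  then have "int t * y ^ 2 + 2 * int r * y = 4 * (int t * m ^ 2 + int r * m)"
    by (simp add: power2_eq_square algebra_simps)
  then show ?thesis using True by (simp only: i_powi_4 if_True)
next
  case False
  then obtain m where "y = 2 * m + 1" by (elim oddE)
  then have "int t * y ^ 2 + 2 * int r * y = 4 * (int t * (m ^ 2 + m) + int r * m) + int (t + 2 * r)"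
    by (simp add: power2_eq_square algebra_simps)
  then have "\<i> powi (int t * y ^ 2 + 2 * int r * y) = \<i> powi int (t + 2 * r)"
    by (simp only: power_int_add[OF disjI1[OF complex_i_not_zero]] i_powi_4 mult_1)
  also have "\<dots> = \<i> ^ t * (- 1) ^ r"
    by (simp only: power_int_of_nat power_add power_mult power2_i)
  finally show ?thesis using False by simp
qed

lemma even_core_form:
  assumes "x \<in> core_vectors t"
  shows "even (core_form t x)"
proof -
  have "core_form t x = int t * (\<Sum>r<t. x r ^ 2) + 2 * (\<Sum>r<t. int r * x r)"
    by (simp add: core_form_def sum.distrib sum_distrib_left algebra_simps)
  then show ?thesis using even_sum_squares[OF assms] by simp
qed

lemma powi_sum:
  fixes z :: "'a::field"
  assumes "z \<noteq> 0"
  shows "z powi (\<Sum>r\<in>A. g r) = (\<Prod>r\<in>A. z powi g r)"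
  by (induction A rule: infinite_finite_induct) (simp_all add: power_int_add assms)

text \<open>The core size is half of \<open>core_form\<close>, so its sign is a power of
  \<open>\<i>\<close> with exponent \<open>core_form\<close>, which factors over the
  runners.\<close>

lemma par_core_form:
  assumes "x \<in> core_vectors t"
  shows "complex_of_real (par (core_form t x div 2))
    = (\<Prod>r<t. if even (x r) then 1 else \<i> ^ t * (- 1) ^ r)"
proof -
  have "complex_of_real (par (core_form t x div 2)) = (- 1) powi (core_form t x div 2)"
    by (simp add: par_def power_int_minus_left)
  also have "\<dots> = \<i> powi (2 * (core_form t x div 2))"
    by (simp add: power_int_mult)
  also have "2 * (core_form t x div 2) = core_form t x" using even_core_form[OF assms] by simp
  also have "\<i> powi core_form t x = (\<Prod>r<t. if even (x r) then 1 else \<i> ^ t * (- 1) ^ r)"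
    unfolding core_form_def by (simp add: powi_sum i_powi_term)
  finally show ?thesis .
qed

text \<open>Adding an odd number on \<open>S\<close> toggles the parities there, so every parity
  pattern occurs for exactly one \<open>S\<close>, and the sum of products factors.\<close>

lemma sum_Pow_prod_parity:
  fixes F :: "'b \<Rightarrow> bool \<Rightarrow> 'a::comm_semiring_1"
  assumes "finite A" "odd t"
  shows "(\<Sum>S\<in>Pow A. \<Prod>j\<in>A. F j (even (x j + (if j \<in> S then int t else 0))))
    = (\<Prod>j\<in>A. F j True + F j False)"
proof -
  have "(\<Prod>j\<in>A. F j True + F j False) = (\<Prod>j\<in>A. F j (odd (x j)) + F j (even (x j)))"
  proof (rule prod.cong[OF refl])
    fix j
    show "F j True + F j False = F j (odd (x j)) + F j (even (x j))"
      by (cases "even (x j)") (simp_all add: add.commute)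
  qed
  also have "\<dots> = (\<Sum>S\<in>Pow A. (\<Prod>j\<in>S. F j (odd (x j))) * (\<Prod>j\<in>A - S. F j (even (x j))))"
    by (rule prod_add[OF assms(1)])
  also have "\<dots> = (\<Sum>S\<in>Pow A. \<Prod>j\<in>A. F j (even (x j + (if j \<in> S then int t else 0))))"
  proof (rule sum.cong[OF refl])
    fix S assume S: "S \<in> Pow A"
    have "(\<Prod>j\<in>A. F j (even (x j + (if j \<in> S then int t else 0))))
        = (\<Prod>j\<in>A - S. F j (even (x j + (if j \<in> S then int t else 0))))
          * (\<Prod>j\<in>S. F j (even (x j + (if j \<in> S then int t else 0))))"
      using S assms(1) by (intro prod.subset_diff) auto
    also have "(\<Prod>j\<in>A - S. F j (even (x j + (if j \<in> S then int t else 0))))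
        = (\<Prod>j\<in>A - S. F j (even (x j)))" by (intro prod.cong) auto
    also have "(\<Prod>j\<in>S. F j (even (x j + (if j \<in> S then int t else 0))))
        = (\<Prod>j\<in>S. F j (odd (x j)))" using assms(2) by (intro prod.cong) auto
    finally show "(\<Prod>j\<in>S. F j (odd (x j))) * (\<Prod>j\<in>A - S. F j (even (x j)))
        = (\<Prod>j\<in>A. F j (even (x j + (if j \<in> S then int t else 0))))" by (simp add: mult.commute)
  qed
  finally show ?thesis by simp
qed

text \<open>Neighbouring factors pair up to
  \<open>(1 - u) * (1 + u) = 1 - u ^ 2 = 2\<close>.\<close>

lemma prod_alternating:
  fixes u :: "'a::comm_ring_1"
  assumes "u ^ 2 = - 1"
  shows "(\<Prod>j\<in>{1..<2 * k + 1}. 1 + u * (- 1) ^ j) = 2 ^ k"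
proof (induction k)
  case (Suc k)
  have "{1..<2 * Suc k + 1} = insert (2 * k + 2) (insert (2 * k + 1) {1..<2 * k + 1})" by auto
  then have "(\<Prod>j\<in>{1..<2 * Suc k + 1}. 1 + u * (- 1) ^ j) = (1 + u) * ((1 - u) * 2 ^ k)"
    using Suc by simp
  also have "\<dots> = (1 - u ^ 2) * 2 ^ k" by (simp add: algebra_simps power2_eq_square)
  finally show ?case using assms by simp
qed simp

text \<open>Entry 0 restores the sum 0. All entries are multiples of \<open>t\<close>, as the
  congruence in \<open>core_average_shift\<close> demands, and for odd \<open>t\<close> adding
  \<open>t\<close> toggles a parity.\<close>

definition shift_vector :: "nat \<Rightarrow> nat set \<Rightarrow> nat \<Rightarrow> int" where
  "shift_vector t S r = (if r = 0 then - int t * int (card S) else if r \<in> S then int t else 0)"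

lemma sum_lessThan_split_0:
  fixes g :: "nat \<Rightarrow> 'a::comm_monoid_add"
  shows "t > 0 \<Longrightarrow> (\<Sum>r<t. g r) = g 0 + (\<Sum>r\<in>{1..<t}. g r)"
  using sum.atLeast_Suc_lessThan[of 0 t g] by (simp add: atLeast0LessThan)

lemma prod_lessThan_split_0:
  fixes g :: "nat \<Rightarrow> 'a::comm_monoid_mult"
  shows "t > 0 \<Longrightarrow> (\<Prod>r<t. g r) = g 0 * (\<Prod>r\<in>{1..<t}. g r)"
  using prod.atLeast_Suc_lessThan[of 0 t g] by (simp add: atLeast0LessThan)

lemma shift_vector_in:
  assumes "t > 0" "S \<subseteq> {1..<t}"
  shows "shift_vector t S \<in> core_vectors t"
proof -
  have "(\<Sum>r\<in>{1..<t}. shift_vector t S r) = (\<Sum>r\<in>{1..<t}. if r \<in> S then int t else 0)"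
    by (intro sum.cong) (auto simp: shift_vector_def)
  also have "\<dots> = int (card ({1..<t} \<inter> S)) * int t"
    by (simp flip: sum.inter_restrict)
  also have "{1..<t} \<inter> S = S" using assms(2) by auto
  finally have "(\<Sum>r<t. shift_vector t S r) = 0"
    by (simp add: sum_lessThan_split_0[OF assms(1)]) (simp add: shift_vector_def)
  then show ?thesis using assms by (auto simp: core_vectors_def shift_vector_def)
qed

text \<open>The odd entries of a core vector are even in number, which determines the parity of its
  zeroth entry; this constraint is removed by splitting the zeroth factor into its even and odd
  parts with respect to the character \<open>(- 1) ^ x 0\<close>.\<close>

lemma sum_par_shift_vector:
  assumes t: "t = 2 * k + 1" and x: "x \<in> core_vectors t"
  shows "(\<Sum>S\<in>Pow {1..<t}. par (core_form t (line (shift_vector t S) x 1) div 2)) = 2 ^ k"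
proof -
  define u where "u = \<i> ^ t"
  define g where "g j e = (if e then 1 else u * (- 1) ^ j)" for j :: nat and e
  define s :: "bool \<Rightarrow> complex" where "s e = (if e then 1 else - 1)" for e
  have u2: "u ^ 2 = - 1" "(- u) ^ 2 = - 1"
    using t by (simp_all add: u_def power_mult_distrib flip: power_mult)
  have t0: "t > 0" "odd t" using t by simp_all
  let ?e = "\<lambda>S j. even (x j + (if j \<in> S then int t else 0))"
  have "complex_of_real (par (core_form t (line (shift_vector t S) x 1) div 2))
      = (1 + u) / 2 * (\<Prod>j\<in>{1..<t}. g j (?e S j))
        + (1 - u) / 2 * (\<Prod>j\<in>{1..<t}. s (?e S j) * g j (?e S j))" if S: "S \<in> Pow {1..<t}" for S
  proof -
    let ?y = "line (shift_vector t S) x 1"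
    have y: "?y \<in> core_vectors t"
      using S by (intro line_in_core_vectors x shift_vector_in t0) auto
    have par: "even (?y j) \<longleftrightarrow> ?e S j" if "j \<in> {1..<t}" for j
      using that by (auto simp: line_def shift_vector_def)
    have s_add: "s (even (a + b)) = s (even a) * s (even b)" for a b :: int
      by (simp add: s_def)
    have s_sum: "s (even (\<Sum>r\<in>B. z r)) = (\<Prod>r\<in>B. s (even (z r)))" for z :: "nat \<Rightarrow> int" and B
    proof (induction B rule: infinite_finite_induct)
      case (insert r B)
      then show ?case
        unfolding sum.insert[OF insert.hyps] prod.insert[OF insert.hyps] s_add by simp
    qed (simp_all add: s_def)
    have "?y 0 + (\<Sum>r\<in>{1..<t}. ?y r) = 0"
      using y sum_lessThan_split_0[OF t0(1), of ?y] by (simp add: core_vectors_def)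
    then have "even (?y 0) \<longleftrightarrow> even (\<Sum>r\<in>{1..<t}. ?y r)" by presburger
    then have s0: "s (even (?y 0)) = (\<Prod>r\<in>{1..<t}. s (?e S r))"
      by (simp only: s_sum) (intro prod.cong refl arg_cong[of _ _ s] par)
    have "complex_of_real (par (core_form t ?y div 2)) = (\<Prod>r<t. g r (even (?y r)))"
      unfolding par_core_form[OF y] g_def u_def ..
    also have "\<dots> = g 0 (even (?y 0)) * (\<Prod>j\<in>{1..<t}. g j (even (?y j)))"
      by (rule prod_lessThan_split_0[OF t0(1)])
    also have "(\<Prod>j\<in>{1..<t}. g j (even (?y j))) = (\<Prod>j\<in>{1..<t}. g j (?e S j))"
      by (intro prod.cong refl) (simp only: par)
    also have "g 0 (even (?y 0)) = (1 + u) / 2 + (1 - u) / 2 * s (even (?y 0))"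
      by (simp add: g_def s_def field_simps)
    finally show ?thesis unfolding s0 by (simp add: distrib_right prod.distrib mult.assoc)
  qed
  then have "complex_of_real (\<Sum>S\<in>Pow {1..<t}. par (core_form t (line (shift_vector t S) x 1) div 2))
      = (1 + u) / 2 * (\<Sum>S\<in>Pow {1..<t}. \<Prod>j\<in>{1..<t}. g j (?e S j))
        + (1 - u) / 2 * (\<Sum>S\<in>Pow {1..<t}. \<Prod>j\<in>{1..<t}. s (?e S j) * g j (?e S j))"
    by (simp add: sum.distrib sum_distrib_left)
  also have "(\<Sum>S\<in>Pow {1..<t}. \<Prod>j\<in>{1..<t}. g j (?e S j)) = (\<Prod>j\<in>{1..<t}. g j True + g j False)"
    by (rule sum_Pow_prod_parity[OF _ t0(2)]) simp
  also have "\<dots> = 2 ^ k" using prod_alternating[OF u2(1), of k] by (simp add: g_def t)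
  also have "(\<Sum>S\<in>Pow {1..<t}. \<Prod>j\<in>{1..<t}. s (?e S j) * g j (?e S j))
      = (\<Prod>j\<in>{1..<t}. s True * g j True + s False * g j False)"
    by (rule sum_Pow_prod_parity[OF _ t0(2), where F = "\<lambda>j e. s e * g j e"]) simp
  \<comment> \<open>The character \<open>s\<close> turns \<open>u\<close> into \<open>- u\<close>,
    whose square is also -1.\<close>
  also have "\<dots> = 2 ^ k" using prod_alternating[OF u2(2), of k] by (simp add: g_def s_def t)
  also have "(1 + u) / 2 * 2 ^ k + (1 - u) / 2 * 2 ^ k = complex_of_real (2 ^ k)"
    by (simp add: field_simps)
  finally show ?thesis unfolding of_real_eq_iff .
qed

text \<open>For odd \<open>t\<close>, \<open>n\<close> has the parity of the number of hooks plus
  the core size, so \<open>(- 1) ^ n\<close> times the hook sign is the sign \<open>f\<close> of the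
  core size. Each of the \<open>4 ^ k\<close> shifts changes its average negligibly, while the sum
  over all shifts is exactly \<open>2 ^ k\<close> at every point; the quotient is the limit.\<close>

lemma parity_bias_odd:
  assumes t: "t = 2 * k + 1"
  shows "(\<lambda>n. (- 1) ^ n * parity_bias t n) \<longlonglongrightarrow> 1 / 2 ^ k"
proof (rule tendstoI)
  fix \<epsilon> :: real assume "\<epsilon> > 0"
  have t0: "t > 0" using t by simp
  define f where "f x = par (core_form t x div 2)" for x
  let ?sh = "\<lambda>S x. line (shift_vector t S) x 1"
  let ?W = "\<lambda>n x. real (core_count t n x)"
  have "\<forall>\<^sub>F n in sequentially. \<bar>(\<Sum>x\<in>core_support t n. (f x - f (?sh S x)) * ?W n x)\<bar>
      \<le> \<epsilon> / 2 * real (num_partitions n)" if S: "S \<in> Pow {1..<t}" for S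
  \<comment> \<open>The zero shift has no positive entry, which \<open>core_average_shift\<close>
    requires.\<close>
  proof (cases "S = {}")
    case True
    then have "?sh S x = x" for x by (simp add: line_def shift_vector_def fun_eq_iff)
    then show ?thesis using \<open>\<epsilon> > 0\<close> by simp
  next
    case False
    then obtain a where a: "a \<in> S" by auto
    with S have at: "a < t" "shift_vector t S a > 0" using t0 by (auto simp: shift_vector_def)
    have "int t dvd (\<Sum>r<t. int r * shift_vector t S r)"
      by (intro dvd_sum) (auto simp: shift_vector_def)
    from core_average_shift[OF t0 shift_vector_in[OF t0] this at, of "\<epsilon> / 2"] S \<open>\<epsilon> > 0\<close>
    have "\<forall>\<^sub>F n in sequentially. \<forall>f. (\<forall>x. \<bar>f x\<bar> \<le> 1) \<longrightarrow>
      \<bar>(\<Sum>x\<in>core_support t n. (f x - f (?sh S x)) * ?W n x)\<bar> \<le> \<epsilon> / 2 * real (num_partitions n)"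
      by auto
    then show ?thesis
    proof eventually_elim
      case (elim n)
      have "\<forall>x. \<bar>f x\<bar> \<le> 1" by (simp add: f_def abs_par)
      then show ?case using elim by blast
    qed
  qed
  then have "\<forall>\<^sub>F n in sequentially. \<forall>S\<in>Pow {1..<t}.
      \<bar>(\<Sum>x\<in>core_support t n. (f x - f (?sh S x)) * ?W n x)\<bar> \<le> \<epsilon> / 2 * real (num_partitions n)"
    by (intro eventually_ball_finite) auto
  then show "\<forall>\<^sub>F n in sequentially. dist ((- 1) ^ n * parity_bias t n) (1 / 2 ^ k) < \<epsilon>"
  proof eventually_elim
    case (elim n)
    let ?X = "core_support t n" and ?P = "Pow {1..<t}" and ?p = "real (num_partitions n)"
    define b where "b = (- 1) ^ n * parity_bias t n"
    have "f (core_vector t (3 * n) mu) = (- 1) ^ n * par (int (size (t_hooks t mu)))"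
      if "mu \<in> partitions_of n" for mu
    proof -
      have "n \<le> t * (3 * n)" using t by simp
      from size_t_hooks_core[OF t0 this that]
        dvd_mult_div_cancel[OF even_core_form[OF core_vector_in[OF t0 that, of "3 * n"]]]
      have "int n = int t * int (size (t_hooks t mu)) + core_form t (core_vector t (3 * n) mu) div 2"
        by linarith
      then have "even (int n) \<longleftrightarrow> even (int t * int (size (t_hooks t mu))
          + core_form t (core_vector t (3 * n) mu) div 2)" by (rule arg_cong)
      then have "even n \<longleftrightarrow>
          (even (size (t_hooks t mu)) \<longleftrightarrow> even (core_form t (core_vector t (3 * n) mu) div 2))"
        using t by simp
      then show ?thesis by (auto simp: f_def par_def)
    qed
    then have "(\<Sum>x\<in>?X. f x * ?W n x)
        = (\<Sum>mu\<in>partitions_of n. (- 1) ^ n * par (int (size (t_hooks t mu))))"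
      unfolding sum_partitions_by_core[symmetric] by (intro sum.cong) auto
    also have "\<dots> = b * ?p"
      by (simp add: b_def mult.assoc parity_bias_sum flip: sum_distrib_left)
    finally have fb: "(\<Sum>x\<in>?X. f x * ?W n x) = b * ?p" .
    have cardP: "card ?P = 4 ^ k" using t by (simp add: card_Pow power_mult)
    have "(\<Sum>S\<in>?P. \<Sum>x\<in>?X. (f x - f (?sh S x)) * ?W n x)
        = (\<Sum>S\<in>?P. \<Sum>x\<in>?X. f x * ?W n x) - (\<Sum>x\<in>?X. \<Sum>S\<in>?P. f (?sh S x) * ?W n x)"
      by (simp add: left_diff_distrib sum_subtractf sum.swap[of _ ?X])
    also have "(\<Sum>S\<in>?P. \<Sum>x\<in>?X. f x * ?W n x) = 4 ^ k * (b * ?p)"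
      by (simp only: fb sum_constant cardP) simp
    also have "(\<Sum>x\<in>?X. \<Sum>S\<in>?P. f (?sh S x) * ?W n x) = (\<Sum>x\<in>?X. 2 ^ k * ?W n x)"
    proof (rule sum.cong[OF refl])
      fix x assume "x \<in> ?X"
      then have "x \<in> core_vectors t" using core_support_subset[OF t0] by auto
      from sum_par_shift_vector[OF t this]
      show "(\<Sum>S\<in>?P. f (?sh S x) * ?W n x) = 2 ^ k * ?W n x"
        by (simp add: f_def flip: sum_distrib_right)
    qed
    also have "\<dots> = 2 ^ k * ?p" by (simp add: sum_core_count flip: sum_distrib_left)
    finally have "4 ^ k * (b * ?p) - 2 ^ k * ?p
        = (\<Sum>S\<in>?P. \<Sum>x\<in>?X. (f x - f (?sh S x)) * ?W n x)" by simp
    also have "\<bar>\<dots>\<bar> \<le> (\<Sum>S\<in>?P. \<bar>\<Sum>x\<in>?X. (f x - f (?sh S x)) * ?W n x\<bar>)" by (rule sum_abs)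
    also have "\<dots> \<le> (\<Sum>S\<in>?P. \<epsilon> / 2 * ?p)" using elim by (intro sum_mono) blast
    also have "\<dots> = 4 ^ k * (\<epsilon> / 2 * ?p)" by (simp only: sum_constant cardP) simp
    finally have bound: "\<bar>4 ^ k * (b * ?p) - 2 ^ k * ?p\<bar> \<le> 4 ^ k * (\<epsilon> / 2 * ?p)" .
    have pos: "4 ^ k * ?p > 0" using num_partitions_pos[of n] by simp
    have "(4 :: real) ^ k = 2 ^ k * 2 ^ k" by (simp flip: power_mult_distrib)
    then have "4 ^ k * (b * ?p) - 2 ^ k * ?p = (4 ^ k * ?p) * (b - 1 / 2 ^ k)"
      by (simp add: field_simps)
    with bound pos have "(4 ^ k * ?p) * \<bar>b - 1 / 2 ^ k\<bar> \<le> (4 ^ k * ?p) * (\<epsilon> / 2)"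
      by (simp add: abs_mult mult_ac)
    then have "\<bar>b - 1 / 2 ^ k\<bar> \<le> \<epsilon> / 2" using pos by (simp only: mult_le_cancel_left_pos)
    then show ?case using \<open>\<epsilon> > 0\<close> unfolding b_def dist_real_def by linarith
  qed
qed

theorem theorem1p12:
  fixes t :: nat
  assumes "t > 1"
  shows "(even t \<longrightarrow>
            delta_even t \<longlonglongrightarrow> 1 / 2 \<and>
            delta_odd t \<longlonglongrightarrow> 1 / 2)
       \<and> (odd t \<longrightarrow>
            (delta_even t \<longlongrightarrow> 1 / 2 + 1 / 2 ^ ((t + 1) div 2)) (inf sequentially (principal {n. even n})) \<and>
            (delta_odd t \<longlongrightarrow> 1 / 2 - 1 / 2 ^ ((t + 1) div 2)) (inf sequentially (principal {n. even n})) \<and>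
            (delta_even t \<longlongrightarrow> 1 / 2 - 1 / 2 ^ ((t + 1) div 2)) (inf sequentially (principal {n. odd n})) \<and>
            (delta_odd t \<longlongrightarrow> 1 / 2 + 1 / 2 ^ ((t + 1) div 2)) (inf sequentially (principal {n. odd n})))"
proof (intro conjI[of "even t \<longrightarrow> _"] impI)
  have delta: "delta_even t = (\<lambda>n. 1 / 2 + parity_bias t n / 2)"
    "delta_odd t = (\<lambda>n. 1 / 2 - parity_bias t n / 2)"
    by (intro ext delta_eq_parity_bias)+
  {
    assume "even t"
    then have "parity_bias t \<longlonglongrightarrow> 0" using assms by (intro parity_bias_even) auto
    from tendsto_add[OF tendsto_const[of "1 / 2"] tendsto_divide[OF this tendsto_const[of 2]]]
      tendsto_diff[OF tendsto_const[of "1 / 2"] tendsto_divide[OF this tendsto_const[of 2]]]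
    show "delta_even t \<longlonglongrightarrow> 1 / 2 \<and> delta_odd t \<longlonglongrightarrow> 1 / 2"
      by (simp add: delta)
  next
    assume "odd t"
    then obtain k where k: "t = 2 * k + 1" by (elim oddE)
    \<comment> \<open>The exponent is \<open>k + 1\<close>; the extra factor 2 is the halving in
      \<open>delta_eq_parity_bias\<close>.\<close>
    have exp: "1 / 2 ^ ((t + 1) div 2) = (1 / 2 ^ k) / (2 :: real)" by (simp add: k)
    let ?F = "\<lambda>A :: nat set. inf sequentially (principal A)"
    have lim: "((\<lambda>n. (- 1) ^ n * parity_bias t n) \<longlongrightarrow> 1 / 2 ^ k) (?F A)" for A
      using parity_bias_odd[OF k] by (rule tendsto_mono[rotated]) simp
    \<comment> \<open>On each residue class modulo 2 the sign \<open>(- 1) ^ n\<close> is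
      constant.\<close>
    have "(parity_bias t \<longlongrightarrow> 1 / 2 ^ k) (?F {n. even n})"
      using lim by (rule Lim_transform_eventually) (simp add: eventually_inf_principal)
    moreover have "(parity_bias t \<longlongrightarrow> - (1 / 2 ^ k)) (?F {n. odd n})"
      using tendsto_minus[OF lim]
      by (rule Lim_transform_eventually) (simp add: eventually_inf_principal)
    moreover have "((\<lambda>n. 1 / 2 + parity_bias t n / 2) \<longlongrightarrow> 1 / 2 + c / 2) G"
      "((\<lambda>n. 1 / 2 - parity_bias t n / 2) \<longlongrightarrow> 1 / 2 - c / 2) G"
      if "(parity_bias t \<longlongrightarrow> c) G" for c G
      using that by (auto intro!: tendsto_intros)
    ultimately show "(delta_even t \<longlongrightarrow> 1 / 2 + 1 / 2 ^ ((t + 1) div 2)) (?F {n. even n}) \<and>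
        (delta_odd t \<longlongrightarrow> 1 / 2 - 1 / 2 ^ ((t + 1) div 2)) (?F {n. even n}) \<and>
        (delta_even t \<longlongrightarrow> 1 / 2 - 1 / 2 ^ ((t + 1) div 2)) (?F {n. odd n}) \<and>
        (delta_odd t \<longlongrightarrow> 1 / 2 + 1 / 2 ^ ((t + 1) div 2)) (?F {n. odd n})"
      unfolding delta exp by force
  }
qed

end
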